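(* Suppose that $A\in M_n(\mathbb{C})$ is normal with $m$ distinct eigenvalues $\lambda_1,\dots,\lambda_m$ and $\dim \operatorname{DW}(A)=2$. Order the eigenvalues in such a way that the edges of the convex polygon $\operatorname{DW}(A)$ connect $(\operatorname{Re}\lambda_i,\operatorname{Im}\lambda_i,|\lambda_i|^2)$ to $(\operatorname{Re}\lambda_{i+1},\operatorname{Im}\lambda_{i+1},|\lambda_{i+1}|^2)$ for $1\le i\le m$, with the convention that $\lambda_{m+1}$ is identified with $\lambda_1$. Then $F_N(A)$ is the set enclosed by the hyperbolic arcs $H(\lambda_i,\lambda_{i+1})$, $1\le i\le m$, and possibly by one line segment that connects the points of tangency for a line tangent to (at least) two of the hyperbolic arcs $H(\lambda_i,\lambda_{i+1})$ (the point $0$ possibly being missing from $F_N(A)$ if $0\in\sigma(A)$). Such a flat portion of $\partial F_N(A)$ occurs if and only if the critical level $\alpha$ exists and satisfies $$\min_i|\lambda_i|^2<\alpha<\max_i|\lambda_i|^2 .$$ In that case, the flat portion is the image of the set $\{v\in \operatorname{DW}(A): v_3=\alpha\}$ under the map $h$.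
   Context: The normalized numerical range of $A\in M_n(\mathbb{C})$ is $F_N(A)=\{x^*Ax/(\|x\|\|Ax\|): x\in\mathbb{C}^n, Ax\neq0\}$. With $\operatorname{Re}A=(A+A^* )/2$ and $\operatorname{Im}A=(A-A^* )/(2i)$, the Davis-Wielandt shell of $A$ is $$\operatorname{DW}(A)=\{(x^*(\operatorname{Re}A)x,\ x^*(\operatorname{Im}A)x,\ x^*A^*Ax): x\in\mathbb{C}^n,\ \|x\|=1\}\subset\mathbb{R}^3 .$$ For normal $A$ it is the convex hull of the points $(\operatorname{Re}\lambda,\operatorname{Im}\lambda,|\lambda|^2)$, $\lambda\in\sigma(A)$, each of which is an extreme point. The dimension of a convex set is the dimension of its affine hull. The map $h$ is defined for $v\in\mathbb{R}^3$ with $v_3>0$ by $h(v)=v_3^{-1/2}(v_1+iv_2)$; $F_N(A)$ is the image under $h$ of $\operatorname{DW}(A)\cap\{v_3>0\}$. For distinct $\lambda,\mu\in\mathbb{C}$, $H(\lambda,\mu)=F_N(\operatorname{diag}(\lambda,\mu))$; if $\lambda,\mu\neq 0$ it is an arc (possibly degenerate to a line segment) of a hyperbola centered at the origin with endpoints $\lambda/|\lambda|,\mu/|\mu|$, and if $\mu=0$ it is the segment $(0,\lambda/|\lambda|]$. The set enclosed by a finite family of curves: let $K$ be the closure of the union of the curves; the enclosed set is the union of $K$ with all bounded connected components of $\mathbb{C}\setminus K$. Critical level: let $V$ be the affine plane containing $\operatorname{DW}(A)$, with equation $\eta_1v_1+\eta_2v_2+\eta_3v_3=b$, $\eta=(\eta_1,\eta_2,\eta_3)\ne0$.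 The critical level of $h|_V$ is the solution $\alpha=-b/\eta_3$ of $b+\alpha\eta_3=0$. When $b,\eta_3\neq0$, for any three distinct eigenvalues, say $\lambda_1,\lambda_2,\lambda_3$, it equals $$\alpha=-\begin{vmatrix}\operatorname{Re}\lambda_1&\operatorname{Im}\lambda_1&|\lambda_1|^2\\ \operatorname{Re}\lambda_2&\operatorname{Im}\lambda_2&|\lambda_2|^2\\ \operatorname{Re}\lambda_3&\operatorname{Im}\lambda_3&|\lambda_3|^2\end{vmatrix}\Bigg/\begin{vmatrix}\operatorname{Re}\lambda_1&\operatorname{Im}\lambda_1&1\\ \operatorname{Re}\lambda_2&\operatorname{Im}\lambda_2&1\\ \operatorname{Re}\lambda_3&\operatorname{Im}\lambda_3&1\end{vmatrix}.$$ If $\eta_3=0$ (equivalently, the spectrum of $A$ is collinear) there is no critical level. *)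

theory Defs
  imports "HOL-Analysis.Analysis"
begin

text \<open>The entry of the \<open>1\<times>1\<close> matrix \<open>x\<^sup>*y\<close>.\<close>

definition herm :: "complex ^ 'n \<Rightarrow> complex ^ 'n \<Rightarrow> complex" where
  "herm x y = (\<Sum>i\<in>UNIV. cnj (x $ i) * y $ i)"

definition ctransp :: "complex ^ 'n ^ 'n \<Rightarrow> complex ^ 'n ^ 'n" where
  "ctransp A = (\<chi> i j. cnj (A $ j $ i))"

definition re_part :: "complex ^ 'n ^ 'n \<Rightarrow> complex ^ 'n ^ 'n" where
  "re_part A = (\<chi> i j. (A $ i $ j + ctransp A $ i $ j) / 2)"

definition im_part :: "complex ^ 'n ^ 'n \<Rightarrow> complex ^ 'n ^ 'n" where
  "im_part A = (\<chi> i j. (A $ i $ j - ctransp A $ i $ j) / (2 * \<i>))"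

definition normal_matrix :: "complex ^ 'n ^ 'n \<Rightarrow> bool" where
  "normal_matrix A \<longleftrightarrow> ctransp A ** A = A ** ctransp A"

definition eigenvalues :: "complex ^ 'n ^ 'n \<Rightarrow> complex set" where
  "eigenvalues A = {k. \<exists>x. x \<noteq> 0 \<and> A *v x = k *s x}"

definition diag2 :: "complex \<Rightarrow> complex \<Rightarrow> complex ^ 2 ^ 2" where
  "diag2 l k = vector [vector [l, 0], vector [0, k]]"

definition normalized_numrange :: "complex ^ 'n ^ 'n \<Rightarrow> complex set" where
  "normalized_numrange A =
     {herm x (A *v x) / of_real (norm x * norm (A *v x)) | x. A *v x \<noteq> 0}"

text \<open>The three quadratic forms are those of Hermitian matrices, hence real-valued;
  \<^const>\<open>Re\<close> only converts their values from type \<^typ>\<open>complex\<close> to \<^typ>\<open>real\<close>.\<close>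

definition DW :: "complex ^ 'n ^ 'n \<Rightarrow> (real ^ 3) set" where
  "DW A = {vector [Re (herm x (re_part A *v x)),
                   Re (herm x (im_part A *v x)),
                   Re (herm x ((ctransp A ** A) *v x))] | x. norm x = 1}"

definition DW_point :: "complex \<Rightarrow> real ^ 3" where
  "DW_point l = vector [Re l, Im l, (cmod l)\<^sup>2]"

text \<open>Meaningful only for \<open>v $ 3 > 0\<close>.\<close>

definition h_map :: "real ^ 3 \<Rightarrow> complex" where
  "h_map v = Complex (v $ 1) (v $ 2) / of_real (sqrt (v $ 3))"

text \<open>If \<open>DW A\<close> has affine dimension 2, the plane \<open>\<eta> \<bullet> v = b\<close> containing it is unique and
  the pair \<open>(\<eta>, b)\<close> is unique up to a common factor, so there is at most one critical level,
  and there is none when \<open>\<eta> $ 3 = 0\<close>.  The requirement \<open>\<eta> \<noteq> 0\<close> is part of \<open>\<eta> $ 3 \<noteq> 0\<close>.\<close>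

definition is_critical_level :: "complex ^ 'n ^ 'n \<Rightarrow> real \<Rightarrow> bool" where
  "is_critical_level A \<alpha> \<longleftrightarrow>
     (\<exists>\<eta> b. DW A \<subseteq> {v. \<eta> \<bullet> v = b} \<and> \<eta> $ 3 \<noteq> 0 \<and> b + \<alpha> * \<eta> $ 3 = 0)"

definition hyp_arc :: "complex \<Rightarrow> complex \<Rightarrow> complex set" where
  "hyp_arc l k = normalized_numrange (diag2 l k)"

text \<open>The shell of \<open>diag2 l k\<close> is the segment joining the points of \<open>l\<close> and \<open>k\<close>, and
  \<open>hyp_arc l k\<close> is the image under \<^const>\<open>h_map\<close> of its part with \<open>v $ 3 > 0\<close>.
  This gives the arc its parametrization over \<open>[0,1]\<close>.\<close>

definition arc_param :: "complex \<Rightarrow> complex \<Rightarrow> real \<Rightarrow> complex" where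
  "arc_param l k t = h_map ((1 - t) *\<^sub>R DW_point l + t *\<^sub>R DW_point k)"

text \<open>The line \<open>L\<close> is tangent at \<open>p\<close> to the curve \<open>c\<close> on \<open>[0,1]\<close>: the velocity of \<open>c\<close> at \<open>p\<close>
  (one-sided at the ends of the curve) is parallel to \<open>L\<close>.  The velocity of
  \<open>arc_param l k\<close> is nonzero unless the distinct numbers \<open>l, k \<noteq> 0\<close> are positive multiples
  of each other.  In that case the
  hyperbola degenerates to a segment run through twice, and the velocity vanishes exactly at
  its turning point (its vertex), where any line has contact of order two with the curve and
  is counted as tangent.\<close>

definition tangent_line_at :: "(real \<Rightarrow> complex) \<Rightarrow> complex set \<Rightarrow> complex \<Rightarrow> bool" where
  "tangent_line_at c L p \<longleftrightarrow>
     p \<in> L \<and>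
     (\<exists>t\<in>{0..1}. \<exists>d. c t = p \<and> (c has_vector_derivative d) (at t within {0..1}) \<and> p + d \<in> L)"

definition arcs :: "nat \<Rightarrow> (nat \<Rightarrow> complex) \<Rightarrow> complex set set" where
  "arcs m lam = (\<lambda>i. hyp_arc (lam i) (lam (i + 1))) ` {1..m}"

text \<open>A line segment in the boundary of \<open>F\<close> that connects the points of tangency of a line tangent
  to two of the arcs, and that bounds \<open>F\<close> in addition to the arcs.  The last condition excludes
  segments merely made up of pieces of arcs, which may themselves be straight: for a
  Hermitian matrix all arcs lie on the real line, which is tangent to each of them everywhere.\<close>

definition flat_portion ::
    "complex set \<Rightarrow> nat \<Rightarrow> (nat \<Rightarrow> complex) \<Rightarrow> complex set \<Rightarrow> bool" where
  "flat_portion F m lam S \<longleftrightarrow>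
     (\<exists>p q i j. p \<noteq> q \<and> S = closed_segment p q \<and>
        i \<in> {1..m} \<and> j \<in> {1..m} \<and> i \<noteq> j \<and>
        tangent_line_at (arc_param (lam i) (lam (i + 1))) (affine hull {p, q}) p \<and>
        tangent_line_at (arc_param (lam j) (lam (j + 1))) (affine hull {p, q}) q) \<and>
     S \<subseteq> frontier F \<and>
     \<not> S \<subseteq> closure (\<Union>(arcs m lam))"

definition enclosed :: "complex set set \<Rightarrow> complex set" where
  "enclosed \<C> = closure (\<Union>\<C>) \<union> inside (closure (\<Union>\<C>))"

end

theory Submission
  imports Defs "HOL-Computational_Algebra.Fundamental_Theorem_Algebra"
begin

text \<open>
  A normal matrix has an orthogonal decomposition into eigenspaces, so its shell is the
  convex hull of the points \<^term>\<open>DW_point k\<close> over the eigenvalues \<open>k\<close>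
  (\<open>normal_DW_convex_hull\<close>), and the set in question is the image of a polygon under
  \<^const>\<open>h_map\<close>.  The linear bound \<open>cmod (proj v) \<le> C * v $ 3\<close> on the shell makes the map
  continuous even at the point \<open>0\<close>, with value \<open>0\<close> there; hence the image of the full
  polygon is compact and differs from the range at most by the point \<open>0\<close>.

  Two facts identify this image with an enclosed set.  First, its complement has no
  bounded component: the image meets each ray from the origin in an interval, because the
  part of a convex set lying over a ray is convex; so a point outside can move outward
  along its ray, or else inward to \<open>0\<close>, and then \<open>0\<close> can be separated from the convex set
  of all \<open>proj v\<close> by a line (\<open>inside_h_image_empty\<close>).  Second, its boundary is
  covered by the arcs and at most one further segment, which is seen as follows.

  The points with image \<open>z\<close> lie on the curve \<open>s \<mapsto> (s z, s\<^sup>2)\<close>, \<open>s > 0\<close>, and this curve meets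
  the plane \<open>\<eta> \<bullet> v = b\<close> where \<open>\<eta>\<^sub>3 s\<^sup>2 + x s - b = 0\<close>, with \<open>x\<close> determined by \<open>z\<close>.
  If \<open>\<eta>\<^sub>3 = 0\<close> and \<open>b \<noteq> 0\<close> there is at most one root.  If \<open>\<eta>\<^sub>3 \<noteq> 0\<close> the product of the two
  roots is \<open>- b / \<eta>\<^sub>3\<close>, the critical level \<open>\<alpha>\<close>, so the map is injective on the part
  of the plane on either side of the height \<open>\<alpha>\<close>.  Invariance of domain then shows that
  relative interior points of the polygon, except possibly those at level \<open>\<alpha>\<close>, are sent to
  interior points of the range.  If the whole polygon lies on one side there is no exception, and the
  boundary consists of arcs.  A vertical plane through the origin is the degenerate case;
  there the range lies in a line and is already covered by the arcs.

  If the level \<open>\<alpha>\<close> cuts the interior of the polygon, write the plane as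
  \<open>e \<bullet> proj v = v $ 3 + \<alpha>\<close>.  Then \<open>e \<bullet> h_map v = s + \<alpha> / s\<close> with \<open>s = sqrt (v $ 3)\<close>,
  which is minimal exactly for \<open>s\<^sup>2 = \<alpha>\<close>.  So the chord at level \<open>\<alpha>\<close> is mapped onto a segment
  of a supporting line, and every arc that reaches this line does so with vanishing
  derivative of \<open>e \<bullet> _\<close>, hence tangentially.  Any other flat portion would have
  to leave the arcs, that is, touch this segment in one of its inner points, and therefore lie
  in the supporting line with end points on arcs (\<open>boundary_with_fold\<close>).
\<close>

section \<open>Eigenspace decomposition of normal matrices\<close>

lemma Re_herm: "Re (herm x y) = x \<bullet> y"
  by (simp add: herm_def inner_vec_def inner_complex_def)

lemma herm_self: "herm x x = of_real ((norm x)\<^sup>2)"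
  by (simp add: herm_def power2_norm_eq_inner inner_vec_def complex_eq_iff inner_complex_def)

lemma herm_commute: "herm y x = cnj (herm x y)"
  by (simp add: herm_def mult.commute)

lemma herm_add_right: "herm x (y + z) = herm x y + herm x z"
  by (simp add: herm_def algebra_simps sum.distrib)

lemma herm_scale_right: "herm x (c *s y) = c * herm x y"
  by (simp add: herm_def sum_distrib_left algebra_simps)

lemma herm_scale_left: "herm (c *s x) y = cnj c * herm x y"
  by (simp add: herm_def sum_distrib_left algebra_simps)

lemma scaleR_eq_smult: "r *\<^sub>R x = of_real r *s (x :: complex ^ 'n)"
  by (simp add: vec_eq_iff) (simp add: scaleR_conv_of_real)

lemma herm_zero_right [simp]: "herm x 0 = 0"
  by (simp add: herm_def)

lemma herm_sum_right: "herm x (sum f S) = (\<Sum>k\<in>S. herm x (f k))"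
  by (induction S rule: infinite_finite_induct) (auto simp: herm_add_right)

lemma herm_sum_left: "herm (sum f S) x = (\<Sum>k\<in>S. herm (f k) x)"
  unfolding herm_commute[of _ x] herm_sum_right by simp

lemma herm_adjoint: "herm x (A *v y) = herm (ctransp A *v x) y"
proof -
  have "herm x (A *v y) = (\<Sum>i\<in>UNIV. \<Sum>j\<in>UNIV. cnj (x $ i) * (A $ i $ j * y $ j))"
    by (simp add: herm_def matrix_vector_mult_def sum_distrib_left)
  also have "\<dots> = (\<Sum>j\<in>UNIV. \<Sum>i\<in>UNIV. cnj (x $ i) * (A $ i $ j * y $ j))"
    by (rule sum.swap)
  also have "\<dots> = herm (ctransp A *v x) y"
    by (simp add: herm_def matrix_vector_mult_def sum_distrib_left ctransp_def mult_ac)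
  finally show ?thesis .
qed

lemma ctransp_ctransp [simp]: "ctransp (ctransp A) = A"
  by (simp add: ctransp_def vec_eq_iff)

lemma shell_coordinates:
  "DW A = {vector [Re (herm x (A *v x)), Im (herm x (A *v x)), (norm (A *v x))\<^sup>2] | x. norm x = 1}"
proof -
  have re: "Re (herm x (re_part A *v x)) = Re (herm x (A *v x))" for x
  proof -
    have "re_part A *v x = (1/2) *s (A *v x + ctransp A *v x)"
      by (simp add: vec_eq_iff re_part_def matrix_vector_mult_def sum.distrib sum_distrib_left
          algebra_simps add_divide_distrib)
    moreover have "herm x (ctransp A *v x) = cnj (herm x (A *v x))"
      by (simp add: herm_adjoint flip: herm_commute)
    ultimately show ?thesis
      by (simp add: herm_scale_right herm_add_right)
  qed
  have im: "Re (herm x (im_part A *v x)) = Im (herm x (A *v x))" for x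
  proof -
    have "im_part A *v x = (1/(2*\<i>)) *s (A *v x + (-1) *s (ctransp A *v x))"
      by (simp add: vec_eq_iff im_part_def matrix_vector_mult_def sum_distrib_left
          algebra_simps diff_divide_distrib sum_subtractf sum_negf flip: sum_negf)
    moreover have "herm x (ctransp A *v x) = cnj (herm x (A *v x))"
      by (simp add: herm_adjoint flip: herm_commute)
    ultimately have "herm x (im_part A *v x) = (1/(2*\<i>)) * (herm x (A *v x) - cnj (herm x (A *v x)))"
      by (simp only: herm_scale_right herm_add_right) simp
    then show ?thesis
      by (simp add: Re_divide)
  qed
  have sq: "Re (herm x ((ctransp A ** A) *v x)) = (norm (A *v x))\<^sup>2" for x
    by (simp add: herm_adjoint[of x "ctransp A"] herm_self flip: matrix_vector_mul_assoc)
  show ?thesis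
    by (simp add: DW_def re im sq)
qed

text \<open>The vector \<open>q(A) x\<close>, in Horner form.\<close>

definition poly_act :: "complex ^ 'n ^ 'n \<Rightarrow> complex ^ 'n \<Rightarrow> complex poly \<Rightarrow> complex ^ 'n" where
  "poly_act A x q = fold_coeffs (\<lambda>a v. a *s x + A *v v) q 0"

lemma poly_act_0 [simp]: "poly_act A x 0 = 0"
  by (simp add: poly_act_def)

lemma poly_act_pCons: "poly_act A x (pCons a q) = a *s x + A *v poly_act A x q"
  by (cases "a = 0 \<and> q = 0") (auto simp: poly_act_def)

lemma poly_act_add: "poly_act A x (p + q) = poly_act A x p + poly_act A x q"
  by (induction p q rule: poly_induct2)
     (simp_all add: poly_act_pCons vec.scale_left_distrib matrix_vector_right_distrib)

lemma poly_act_smult: "poly_act A x (smult c p) = c *s poly_act A x p"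
  by (induction p rule: pCons_induct)
     (simp_all add: poly_act_pCons vec.scale_right_distrib vec.scale)

lemma poly_act_monom: "poly_act A x (monom c i) = c *s ((\<lambda>v. A *v v) ^^ i) x"
  by (induction i) (simp_all add: monom_0 monom_Suc poly_act_pCons vec.scale)

lemma poly_act_sum: "poly_act A x (sum f S) = (\<Sum>i\<in>S. poly_act A x (f i))"
  by (induction S rule: infinite_finite_induct) (auto simp: poly_act_add)

text \<open>The vectors \<open>x, A x, \<dots>, A\<^sup>n x\<close> are \<open>n + 1\<close> vectors in an \<open>n\<close>-dimensional space.  A repetition
  among them yields the polynomial directly; otherwise their linear dependence does.\<close>

lemma poly_act_annihilator:
  fixes A :: "complex ^ 'n ^ 'n"
  shows "\<exists>q. q \<noteq> 0 \<and> poly_act A x q = 0"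
proof -
  define f where "f i = ((\<lambda>v. A *v v) ^^ i) x" for i
  define N where "N = CARD('n)"
  show ?thesis
  proof (cases "inj_on f {..N}")
    case False
    then obtain i j where ij: "f i = f j" "i \<noteq> j"
      by (auto simp: inj_on_def)
    let ?q = "monom 1 i + monom (-1) j :: complex poly"
    have "coeff ?q i = 1"
      using ij by simp
    then have "?q \<noteq> 0"
      by (metis coeff_0 zero_neq_one)
    moreover have "poly_act A x ?q = 0"
      using ij by (simp add: poly_act_add poly_act_monom f_def)
    ultimately show ?thesis by blast
  next
    case True
    have "vec.dependent (f ` {..N})"
    proof (rule ccontr)
      assume "\<not> ?thesis"
      then have "card (f ` {..N}) \<le> vec.dim (UNIV :: (complex ^ 'n) set)"
        using vec.independent_card_le_dim[of "f ` {..N}" UNIV] by auto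
      then show False
        using True by (simp add: card_image N_def vec.dim_UNIV card_cart_basis vec_dim_card)
    qed
    then obtain u v where u: "(\<Sum>w\<in>f ` {..N}. u w *s w) = 0" "v \<in> f ` {..N}" "u v \<noteq> 0"
      by (auto simp: vec.dependent_finite)
    then obtain j where j: "j \<le> N" "v = f j" by auto
    let ?q = "\<Sum>i\<le>N. monom (u (f i)) i"
    have "coeff ?q j = u v"
      using j by (simp add: coeff_sum)
    then have "?q \<noteq> 0"
      using u by (metis coeff_0)
    moreover have "poly_act A x ?q = 0"
      using u(1) True by (simp add: poly_act_sum poly_act_monom sum.reindex flip: f_def)
    ultimately show ?thesis by blast
  qed
qed

text \<open>Take an annihilating polynomial \<open>q\<close> of \<open>x\<close> of least degree and split off a root \<open>k\<close>: for
  \<open>q = (X - k) r\<close> the vector \<open>r(A) x\<close> is nonzero by minimality and is killed by \<open>A - k\<close>.\<close>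

lemma invariant_subspace_eigenvector:
  fixes A :: "complex ^ 'n ^ 'n"
  assumes add: "\<And>u v. u \<in> U \<Longrightarrow> v \<in> U \<Longrightarrow> u + v \<in> U"
    and scale: "\<And>c u. u \<in> U \<Longrightarrow> c *s u \<in> U"
    and inv: "\<And>u. u \<in> U \<Longrightarrow> A *v u \<in> U"
    and x: "x \<in> U" "x \<noteq> 0"
  shows "\<exists>y\<in>U. y \<noteq> 0 \<and> (\<exists>k. A *v y = k *s y)"
proof -
  have inU: "poly_act A x q \<in> U" for q
  proof (induction q rule: pCons_induct)
    case 0
    then show ?case using scale[OF x(1), of 0] by simp
  next
    case (pCons a q)
    then show ?case by (simp add: poly_act_pCons add scale inv x)
  qed
  obtain q where q: "q \<noteq> 0" "poly_act A x q = 0"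
    and least: "\<And>r. r \<noteq> 0 \<Longrightarrow> poly_act A x r = 0 \<Longrightarrow> degree q \<le> degree r"
    using ex_has_least_nat[of "\<lambda>q. q \<noteq> 0 \<and> poly_act A x q = 0" _ degree]
      poly_act_annihilator[of A x] by metis
  have "degree q \<noteq> 0"
  proof
    assume "degree q = 0"
    then obtain a where "q = [:a:]" by (rule degree_eq_zeroE)
    then show False
      using q x by (simp add: poly_act_pCons)
  qed
  then obtain k where "poly q k = 0"
    using fundamental_theorem_of_algebra[of q] by (auto simp: constant_degree)
  then obtain r where r: "q = [:-k, 1:] * r"
    by (auto simp: poly_eq_0_iff_dvd)
  with q have "r \<noteq> 0" by auto
  then have "degree q = Suc (degree r)"
    unfolding r by (subst degree_mult_eq) auto
  then have nz: "poly_act A x r \<noteq> 0"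
    using least[OF \<open>r \<noteq> 0\<close>] by auto
  have "q = smult (-k) r + pCons 0 r"
    by (simp add: r)
  then have "poly_act A x q = (-k) *s poly_act A x r + A *v poly_act A x r"
    by (simp only: poly_act_add poly_act_smult poly_act_pCons) simp
  then have "A *v poly_act A x r = k *s poly_act A x r"
    using q(2) by (simp add: vec.scale_minus_left add_eq_0_iff)
  then show ?thesis
    using inU nz by blast
qed

text \<open>Normality gives \<open>\<parallel>A\<^sup>* x\<parallel> = \<parallel>A x\<parallel>\<close>; expanding \<open>\<parallel>A\<^sup>* x - cnj k x\<parallel>\<^sup>2\<close> then leaves \<open>0\<close>.\<close>

lemma normal_adjoint_eigenvector:
  assumes "normal_matrix A" and eig: "A *v x = k *s x"
  shows "ctransp A *v x = cnj k *s x"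
proof -
  let ?y = "ctransp A *v x"
  have "herm ?y ?y = herm x (A *v (ctransp A *v x))"
    by (simp add: herm_adjoint)
  also have "\<dots> = herm x (ctransp A *v (A *v x))"
    using assms(1) by (simp add: normal_matrix_def matrix_vector_mul_assoc)
  also have "\<dots> = herm (A *v x) (A *v x)"
    by (simp add: herm_adjoint[of x "ctransp A"])
  finally have 1: "?y \<bullet> ?y = (A *v x) \<bullet> (A *v x)"
    by (metis Re_herm)
  have "herm ?y (cnj k *s x) = cnj k * herm x (k *s x)"
    by (simp add: herm_scale_right eig flip: herm_adjoint)
  also have "\<dots> = herm (k *s x) (k *s x)"
    by (simp add: herm_scale_right herm_scale_left)
  finally have 2: "?y \<bullet> (cnj k *s x) = (k *s x) \<bullet> (k *s x)"
    by (metis Re_herm)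
  have 3: "(cnj k *s x) \<bullet> (cnj k *s x) = (k *s x) \<bullet> (k *s x)"
    by (simp add: herm_scale_right herm_scale_left algebra_simps flip: Re_herm)
  have "(?y - cnj k *s x) \<bullet> (?y - cnj k *s x) = 0"
    using 1 2 3 eig by (simp add: inner_diff inner_commute)
  then show ?thesis by simp
qed

lemma normal_eigenvectors_orthogonal:
  assumes "normal_matrix A" "A *v x = k *s x" "A *v y = l *s y" "k \<noteq> l"
  shows "herm x y = 0"
proof -
  have "l * herm x y = herm x (A *v y)"
    by (simp add: assms herm_scale_right)
  also have "\<dots> = k * herm x y"
    by (simp add: herm_adjoint normal_adjoint_eigenvector[OF assms(1,2)] herm_scale_left)
  finally show ?thesis using assms(4) by simp
qed

lemma finite_eigenvalues_normal:
  fixes A :: "complex ^ 'n ^ 'n"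
  assumes "normal_matrix A"
  shows "finite (eigenvalues A)"
proof -
  have "\<forall>k\<in>eigenvalues A. \<exists>x. x \<noteq> 0 \<and> A *v x = k *s x"
    by (simp add: eigenvalues_def)
  from bchoice[OF this]
  obtain e where e: "\<And>k. k \<in> eigenvalues A \<Longrightarrow> e k \<noteq> 0 \<and> A *v e k = k *s e k"
    by blast
  have orth: "e k \<bullet> e l = 0" if "k \<in> eigenvalues A" "l \<in> eigenvalues A" "k \<noteq> l" for k l
    using normal_eigenvectors_orthogonal[OF assms, of "e k" k "e l" l] e that
    by (simp flip: Re_herm)
  have "inj_on e (eigenvalues A)"
    using e orth by (metis inj_onI inner_eq_zero_iff)
  moreover have "independent (e ` eigenvalues A)"
    using e orth
    by (intro pairwise_orthogonal_independent) (auto simp: pairwise_def orthogonal_def)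
  ultimately show ?thesis
    using finite_imageD independent_imp_finite by blast
qed

text \<open>The sums of eigenvectors form a subspace \<open>W\<close>, invariant under \<open>A\<^sup>*\<close>.  So its orthogonal
  complement is invariant under \<open>A\<close>, and if it were nonzero it would contain an eigenvector,
  which also lies in \<open>W\<close>.\<close>

lemma normal_eigen_decomposition:
  fixes A :: "complex ^ 'n ^ 'n"
  assumes "normal_matrix A"
  obtains f where "\<And>k. k \<in> eigenvalues A \<Longrightarrow> A *v f k = k *s f k" "x = (\<Sum>k\<in>eigenvalues A. f k)"
proof -
  define W where "W = {\<Sum>k\<in>eigenvalues A. f k | f. \<forall>k\<in>eigenvalues A. A *v f k = k *s f k}"
  have scale: "c *s w \<in> W" if "w \<in> W" for c w
  proof -
    from that obtain f where "w = (\<Sum>k\<in>eigenvalues A. f k)" "\<forall>k\<in>eigenvalues A. A *v f k = k *s f k"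
      by (auto simp: W_def)
    then show ?thesis
      unfolding W_def
      by (intro CollectI exI[of _ "\<lambda>k. c *s f k"])
        (auto simp: vec.scale vec.scale_sum_right mult.commute)
  qed
  have "subspace W"
  proof (rule subspaceI)
    show "0 \<in> W"
      unfolding W_def by (intro CollectI exI[of _ "\<lambda>_. 0"]) auto
  next
    fix v w assume "v \<in> W" "w \<in> W"
    then obtain f g where "v = (\<Sum>k\<in>eigenvalues A. f k)" "\<forall>k\<in>eigenvalues A. A *v f k = k *s f k"
      "w = (\<Sum>k\<in>eigenvalues A. g k)" "\<forall>k\<in>eigenvalues A. A *v g k = k *s g k"
      by (auto simp: W_def)
    then show "v + w \<in> W"
      unfolding W_def
      by (intro CollectI exI[of _ "\<lambda>k. f k + g k"])
        (auto simp: sum.distrib vec.scale_right_distrib matrix_vector_right_distrib)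
  next
    fix c :: real and w assume "w \<in> W"
    moreover have "c *\<^sub>R w = complex_of_real c *s w"
      by (simp add: scaleR_eq_smult)
    ultimately show "c *\<^sub>R w \<in> W"
      using scale by metis
  qed
  obtain y z where yz: "y \<in> span W" "\<And>w. w \<in> span W \<Longrightarrow> orthogonal z w" "x = y + z"
    using orthogonal_subspace_decomp_exists[of W x] by metis
  define U where "U = {u. \<forall>w\<in>W. herm w u = 0}"
  have zU: "z \<in> U"
  proof -
    have "Re (herm w z) = 0" if "w \<in> W" for w
      using yz(2)[of w] that by (simp add: Re_herm orthogonal_def inner_commute span_base)
    \<comment> \<open>the real inner product only sees the real part of the form; testing with \<open>\<i> w\<close> gives the rest\<close>
    from this[OF scale, of _ \<i>] this show ?thesis
      by (auto simp: U_def herm_scale_left complex_eq_iff)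
  qed
  have "z = 0"
  proof (rule ccontr)
    assume "z \<noteq> 0"
    have "\<exists>y\<in>U. y \<noteq> 0 \<and> (\<exists>k. A *v y = k *s y)"
    proof (rule invariant_subspace_eigenvector[OF _ _ _ zU \<open>z \<noteq> 0\<close>])
      fix u assume "u \<in> U"
      have "herm w (A *v u) = 0" if w: "w \<in> W" for w
      proof -
        obtain f where f: "w = (\<Sum>k\<in>eigenvalues A. f k)" "\<And>k. k\<in>eigenvalues A \<Longrightarrow> A *v f k = k *s f k"
          using w by (auto simp: W_def)
        then have "ctransp A *v w = (\<Sum>k\<in>eigenvalues A. cnj k *s f k)"
          by (auto simp: vec.linear_sum intro!: sum.cong normal_adjoint_eigenvector[OF assms])
        also have "\<dots> \<in> W"
          unfolding W_def using f
          by (intro CollectI exI[of _ "\<lambda>k. cnj k *s f k"]) (simp add: vec.scale mult.commute)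
        finally show ?thesis
          using \<open>u \<in> U\<close> by (simp add: herm_adjoint U_def)
      qed
      then show "A *v u \<in> U" by (simp add: U_def)
    qed (auto simp: U_def herm_add_right herm_scale_right)
    then obtain v k where v: "v \<in> U" "v \<noteq> 0" "A *v v = k *s v" by blast
    then have k: "k \<in> eigenvalues A" by (auto simp: eigenvalues_def)
    have "v \<in> W"
      unfolding W_def using v k finite_eigenvalues_normal[OF assms]
      by (intro CollectI exI[of _ "\<lambda>j. if j = k then v else 0"]) (auto)
    then have "herm v v = 0" using v by (simp add: U_def)
    then show False using v by (simp add: herm_self)
  qed
  then have "x \<in> span W"
    using yz by simp
  also have "span W = W"
    using \<open>subspace W\<close> by (simp add: span_eq_iff)
  finally have "x \<in> W" .
  then show thesis
    using that by (auto simp: W_def)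
qed

text \<open>Orthogonality of the eigenspaces removes all mixed terms, so the shell point of a unit
  vector is the convex combination weighted by the squared norms of its components.\<close>

lemma eigenvector_sum_shell_point:
  fixes A :: "complex ^ 'n ^ 'n"
  assumes "normal_matrix A" and f: "\<And>k. k \<in> eigenvalues A \<Longrightarrow> A *v f k = k *s f k"
    and x: "x = (\<Sum>k\<in>eigenvalues A. f k)"
  shows "(norm x)\<^sup>2 = (\<Sum>k\<in>eigenvalues A. (norm (f k))\<^sup>2)"
    and "vector [Re (herm x (A *v x)), Im (herm x (A *v x)), (norm (A *v x))\<^sup>2] =
         (\<Sum>k\<in>eigenvalues A. (norm (f k))\<^sup>2 *\<^sub>R DW_point k)"
proof -
  note fin = finite_eigenvalues_normal[OF assms(1)]
  have orth: "herm (\<Sum>k\<in>eigenvalues A. a k *s f k) (\<Sum>k\<in>eigenvalues A. b k *s f k) =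
      (\<Sum>k\<in>eigenvalues A. cnj (a k) * b k * of_real ((norm (f k))\<^sup>2))" (is "?l = ?r") for a b
  proof -
    have "?l = (\<Sum>k\<in>eigenvalues A. \<Sum>l\<in>eigenvalues A. cnj (a k) * b l * herm (f k) (f l))"
      by (simp add: herm_sum_left herm_scale_left)
        (simp add: herm_sum_right herm_scale_right sum_distrib_left mult.assoc)
    also have "\<dots> = (\<Sum>k\<in>eigenvalues A. \<Sum>l\<in>eigenvalues A.
        if k = l then cnj (a k) * b k * herm (f k) (f k) else 0)"
      by (intro sum.cong refl) (auto intro!: normal_eigenvectors_orthogonal[OF assms(1)] f)
    also have "\<dots> = ?r"
      using fin by (simp add: herm_self)
    finally show ?thesis .
  qed
  have x1: "x = (\<Sum>k\<in>eigenvalues A. 1 *s f k)" by (simp add: x)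
  have Ax: "A *v x = (\<Sum>k\<in>eigenvalues A. k *s f k)"
    by (simp add: x vec.linear_sum f)
  have "herm x x = of_real (\<Sum>k\<in>eigenvalues A. (norm (f k))\<^sup>2)"
    unfolding x1 orth by simp
  then show "(norm x)\<^sup>2 = (\<Sum>k\<in>eigenvalues A. (norm (f k))\<^sup>2)"
    unfolding herm_self of_real_eq_iff .
  have 1: "herm x (A *v x) = (\<Sum>k\<in>eigenvalues A. k * of_real ((norm (f k))\<^sup>2))"
    unfolding Ax by (subst x1, subst orth) simp
  have "herm (A *v x) (A *v x) = of_real (\<Sum>k\<in>eigenvalues A. (norm (f k))\<^sup>2 * (cmod k)\<^sup>2)"
    unfolding Ax orth
    by (simp only: of_real_sum of_real_mult complex_norm_square) (simp add: mult_ac)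
  then have 2: "(norm (A *v x))\<^sup>2 = (\<Sum>k\<in>eigenvalues A. (norm (f k))\<^sup>2 * (cmod k)\<^sup>2)"
    unfolding herm_self of_real_eq_iff .
  show "vector [Re (herm x (A *v x)), Im (herm x (A *v x)), (norm (A *v x))\<^sup>2] =
         (\<Sum>k\<in>eigenvalues A. (norm (f k))\<^sup>2 *\<^sub>R DW_point k)"
    unfolding 1 2 by (simp add: vec_eq_iff forall_3 DW_point_def mult.commute)
qed

lemma inj_DW_point: "inj DW_point"
  by (auto simp: inj_def DW_point_def vec_eq_iff forall_3 complex_eq_iff)

lemma normal_DW_convex_hull:
  fixes A :: "complex ^ 'n ^ 'n"
  assumes "normal_matrix A"
  shows "DW A = convex hull (DW_point ` eigenvalues A)"
proof (intro equalityI subsetI)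
  note fin = finite_eigenvalues_normal[OF assms]
  fix v assume "v \<in> DW A"
  then obtain x where x: "norm x = 1"
    "v = vector [Re (herm x (A *v x)), Im (herm x (A *v x)), (norm (A *v x))\<^sup>2]"
    by (auto simp: shell_coordinates)
  obtain f where f: "\<And>k. k \<in> eigenvalues A \<Longrightarrow> A *v f k = k *s f k" "x = (\<Sum>k\<in>eigenvalues A. f k)"
    using normal_eigen_decomposition[OF assms] by metis
  have "v = (\<Sum>k\<in>eigenvalues A. (norm (f k))\<^sup>2 *\<^sub>R DW_point k)"
    using eigenvector_sum_shell_point(2)[OF assms f] x by simp
  also have "\<dots> \<in> convex hull (DW_point ` eigenvalues A)"
    using eigenvector_sum_shell_point(1)[OF assms f] x(1) fin
    by (intro convex_sum convex_convex_hull hull_inc) auto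
  finally show "v \<in> convex hull (DW_point ` eigenvalues A)" .
next
  note fin = finite_eigenvalues_normal[OF assms]
  fix v assume "v \<in> convex hull (DW_point ` eigenvalues A)"
  then obtain u where u: "\<And>k. k \<in> eigenvalues A \<Longrightarrow> 0 \<le> u (DW_point k)"
    "sum u (DW_point ` eigenvalues A) = 1"
    "(\<Sum>p\<in>DW_point ` eigenvalues A. u p *\<^sub>R p) = v"
    using fin by (auto simp: convex_hull_finite)
  have "\<forall>k\<in>eigenvalues A. \<exists>x. x \<noteq> 0 \<and> A *v x = k *s x"
    by (simp add: eigenvalues_def)
  from bchoice[OF this]
  obtain e where e: "\<And>k. k \<in> eigenvalues A \<Longrightarrow> e k \<noteq> 0 \<and> A *v e k = k *s e k"
    by blast
  define f where "f k = of_real (sqrt (u (DW_point k)) / norm (e k)) *s e k" for k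
  define x where "x = (\<Sum>k\<in>eigenvalues A. f k)"
  have f: "A *v f k = k *s f k" if "k \<in> eigenvalues A" for k
    using e[OF that] by (simp add: f_def vec.scale mult.commute)
  have n: "(norm (f k))\<^sup>2 = u (DW_point k)" if "k \<in> eigenvalues A" for k
  proof -
    have "f k = (sqrt (u (DW_point k)) / norm (e k)) *\<^sub>R e k"
      by (simp add: f_def scaleR_eq_smult)
    then show ?thesis
      using e[OF that] u(1)[OF that] by (simp add: power_mult_distrib power_divide)
  qed
  have inj: "inj_on DW_point (eigenvalues A)"
    using inj_DW_point by (rule inj_on_subset) simp
  have "(norm x)\<^sup>2 = (\<Sum>k\<in>eigenvalues A. (norm (f k))\<^sup>2)"
    by (rule eigenvector_sum_shell_point(1)[OF assms f x_def])
  then have "(norm x)\<^sup>2 = 1"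
    using u(2) n inj by (simp add: sum.reindex)
  then have "norm x = 1"
    by (simp add: power2_eq_1_iff) (smt (verit) norm_ge_zero)
  moreover have "vector [Re (herm x (A *v x)), Im (herm x (A *v x)), (norm (A *v x))\<^sup>2] =
      (\<Sum>k\<in>eigenvalues A. (norm (f k))\<^sup>2 *\<^sub>R DW_point k)"
    by (rule eigenvector_sum_shell_point(2)[OF assms f x_def])
  then have "v = vector [Re (herm x (A *v x)), Im (herm x (A *v x)), (norm (A *v x))\<^sup>2]"
    using u(3) n inj by (simp add: sum.reindex)
  ultimately show "v \<in> DW A"
    by (auto simp: shell_coordinates)
qed

text \<open>The quotient does not change when \<open>x\<close> is scaled, so \<open>x\<close> may be taken of norm 1.\<close>

lemma normalized_numrange_h_map:
  "normalized_numrange A = h_map ` (DW A \<inter> {v. 0 < v $ 3})"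
proof -
  have key: "herm x (A *v x) / of_real (norm x * norm (A *v x)) =
      h_map (vector [Re (herm x (A *v x)), Im (herm x (A *v x)), (norm (A *v x))\<^sup>2])"
    if "norm x = 1" for x
    using that by (simp add: h_map_def)
  show ?thesis
  proof (intro equalityI subsetI)
    fix z assume "z \<in> normalized_numrange A"
    then obtain x where x: "A *v x \<noteq> 0" "z = herm x (A *v x) / of_real (norm x * norm (A *v x))"
      by (auto simp: normalized_numrange_def)
    then have "x \<noteq> 0" by auto
    define c where "c = complex_of_real (1 / norm x)"
    define y where "y = c *s x"
    have "c \<noteq> 0" using \<open>x \<noteq> 0\<close> by (simp add: c_def)
    have yR: "y = (1 / norm x) *\<^sub>R x"
      by (simp add: y_def c_def scaleR_eq_smult)
    then have ny: "norm y = 1" using \<open>x \<noteq> 0\<close> by simp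
    have Ay: "A *v y = c *s (A *v x)" by (simp add: y_def vec.scale)
    then have "A *v y \<noteq> 0" using x \<open>c \<noteq> 0\<close> by simp
    have "A *v y = (1 / norm x) *\<^sub>R (A *v x)"
      unfolding Ay by (simp add: c_def scaleR_eq_smult)
    then have "norm (A *v y) = norm (A *v x) / norm x" by simp
    moreover have "herm y (A *v y) = herm x (A *v x) / of_real ((norm x)\<^sup>2)"
      unfolding Ay
      by (simp add: y_def herm_scale_left herm_scale_right c_def power2_eq_square)
    ultimately have "z = herm y (A *v y) / of_real (norm y * norm (A *v y))"
      using \<open>x \<noteq> 0\<close> x(2) ny by (simp add: power2_eq_square)
    then show "z \<in> h_map ` (DW A \<inter> {v. 0 < v $ 3})"
      unfolding key[OF ny] using ny \<open>A *v y \<noteq> 0\<close>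
      by (intro image_eqI[OF _ IntI]) (auto simp: shell_coordinates)
  next
    fix z assume "z \<in> h_map ` (DW A \<inter> {v. 0 < v $ 3})"
    then obtain x where "norm x = 1" "A *v x \<noteq> 0"
      "z = h_map (vector [Re (herm x (A *v x)), Im (herm x (A *v x)), (norm (A *v x))\<^sup>2])"
      by (auto simp: shell_coordinates)
    then show "z \<in> normalized_numrange A"
      unfolding normalized_numrange_def by (metis (mono_tags, lifting) key mem_Collect_eq)
  qed
qed

lemma normal_diag2: "normal_matrix (diag2 l k)"
  by (simp add: normal_matrix_def diag2_def ctransp_def matrix_matrix_mult_def vec_eq_iff forall_2
      sum_2)

lemma eigenvalues_diag2: "eigenvalues (diag2 l k) = {l, k}"
proof (intro equalityI subsetI)
  fix c assume "c \<in> eigenvalues (diag2 l k)"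
  then show "c \<in> {l, k}"
    by (auto simp: eigenvalues_def diag2_def matrix_vector_mult_def vec_eq_iff forall_2 sum_2)
next
  fix c assume "c \<in> {l, k}"
  moreover have "l \<in> eigenvalues (diag2 l k)"
    unfolding eigenvalues_def
    by (intro CollectI exI[of _ "vector [1, 0]"])
      (simp add: diag2_def matrix_vector_mult_def vec_eq_iff forall_2 sum_2)
  moreover have "k \<in> eigenvalues (diag2 l k)"
    unfolding eigenvalues_def
    by (intro CollectI exI[of _ "vector [0, 1]"])
      (simp add: diag2_def matrix_vector_mult_def vec_eq_iff forall_2 sum_2)
  ultimately show "c \<in> eigenvalues (diag2 l k)" by auto
qed

lemma hyp_arc_h_map:
  "hyp_arc l k = h_map ` (closed_segment (DW_point l) (DW_point k) \<inter> {v. 0 < v $ 3})"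
  by (simp add: hyp_arc_def normalized_numrange_h_map normal_DW_convex_hull[OF normal_diag2]
      eigenvalues_diag2 segment_convex_hull)

section \<open>The map \<open>h\<close> on a convex shell\<close>

definition proj :: "real ^ 3 \<Rightarrow> complex" where
  "proj v = Complex (v $ 1) (v $ 2)"

lemma linear_proj: "linear proj"
  by (rule linearI) (simp_all add: proj_def complex_eq_iff)

lemma h_map_proj: "h_map v = (1 / sqrt (v $ 3)) *\<^sub>R proj v"
  by (simp add: h_map_def proj_def scaleR_conv_of_real)

lemma proj_DW_point [simp]: "proj (DW_point l) = l"
  by (simp add: proj_def DW_point_def complex_eq_iff)

lemma DW_point_3 [simp]: "DW_point l $ 3 = (cmod l)\<^sup>2"
  by (simp add: DW_point_def)

lemma proj_eqI: "proj v = proj w \<Longrightarrow> v $ 3 = w $ 3 \<Longrightarrow> v = w"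
  by (simp add: proj_def vec_eq_iff forall_3)

lemma continuous_on_proj: "continuous_on S proj"
  by (rule linear_continuous_on) (simp add: linear_proj linear_conv_bounded_linear[symmetric])

text \<open>On the spectrum the bound reads \<open>cmod k \<le> C (cmod k)\<^sup>2\<close>, which holds with \<open>C\<close> above the
  inverse of every nonzero \<open>cmod k\<close>.  The bound survives convex combinations, its left side
  being convex and its right side linear in \<open>v\<close>.\<close>

lemma shell_linear_bound:
  assumes "finite \<sigma>"
  obtains C where "C > 0" "\<And>v. v \<in> convex hull (DW_point ` \<sigma>) \<Longrightarrow> cmod (proj v) \<le> C * v $ 3"
proof -
  define C where "C = 1 + (\<Sum>k\<in>\<sigma>. 1 / cmod k)"
  have "C > 0"
    unfolding C_def by (smt (verit) divide_nonneg_nonneg norm_ge_zero sum_nonneg)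
  have "convex {v :: real ^ 3. cmod (proj v) \<le> C * v $ 3}"
  proof (rule convexI, simp)
    fix v w :: "real ^ 3" and a b :: real
    assume h: "cmod (proj v) \<le> C * v $ 3" "cmod (proj w) \<le> C * w $ 3" "0 \<le> a" "0 \<le> b"
    have "cmod (proj (a *\<^sub>R v + b *\<^sub>R w)) \<le> a * cmod (proj v) + b * cmod (proj w)"
      using h norm_triangle_ineq[of "a *\<^sub>R proj v" "b *\<^sub>R proj w"]
      by (simp add: linear_add[OF linear_proj] linear_cmul[OF linear_proj])
    also have "\<dots> \<le> a * (C * v $ 3) + b * (C * w $ 3)"
      using h by (intro add_mono mult_left_mono)
    finally show "cmod (proj (a *\<^sub>R v + b *\<^sub>R w)) \<le> C * (a * v $ 3 + b * w $ 3)"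
      by (simp add: algebra_simps)
  qed
  moreover have "cmod k \<le> C * (cmod k)\<^sup>2" if "k \<in> \<sigma>" for k
  proof (cases "k = 0")
    case False
    have "1 / cmod k \<le> C"
      unfolding C_def using member_le_sum[OF that, of "\<lambda>k. 1 / cmod k"] assms by simp
    then show ?thesis
      using False by (simp add: field_simps power2_eq_square)
  qed simp
  ultimately have "convex hull (DW_point ` \<sigma>) \<subseteq> {v. cmod (proj v) \<le> C * v $ 3}"
    by (intro hull_minimal) auto
  then show thesis
    using that \<open>C > 0\<close> by blast
qed

text \<open>At height \<open>0\<close> the bound gives \<open>cmod (h_map w) \<le> C * sqrt (w $ 3)\<close>, so the
  value \<open>0\<close> that division by zero assigns there is the limit.\<close>

lemma continuous_on_h_map:
  assumes "C > 0" and bound: "\<And>v. v \<in> P \<Longrightarrow> cmod (proj v) \<le> C * v $ 3"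
  shows "continuous_on P h_map"
  unfolding continuous_on_eq_continuous_within
proof
  fix v assume v: "v \<in> P"
  have "v $ 3 \<ge> 0"
    using bound[OF v] assms(1) by (smt (verit) norm_ge_zero zero_le_mult_iff)
  show "continuous (at v within P) h_map"
  proof (cases "v $ 3 = 0")
    case False
    have "(proj \<longlongrightarrow> proj v) (at v within P)"
      using continuous_on_proj v by (auto simp: continuous_on_def)
    then have "((\<lambda>v. (1 / sqrt (v $ 3)) *\<^sub>R proj v) \<longlongrightarrow> (1 / sqrt (v $ 3)) *\<^sub>R proj v) (at v within P)"
      using False by (intro tendsto_intros) auto
    moreover have "h_map = (\<lambda>v. (1 / sqrt (v $ 3)) *\<^sub>R proj v)"
      by (simp add: fun_eq_iff h_map_proj)
    ultimately show ?thesis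
      unfolding continuous_within by (simp add: h_map_proj)
  next
    case True
    have "(h_map \<longlongrightarrow> 0) (at v within P)"
    proof (rule Lim_null_comparison)
      have "((\<lambda>w. C * sqrt (w $ 3)) \<longlongrightarrow> C * sqrt (v $ 3)) (at v within P)"
        by (intro tendsto_intros)
      then show "((\<lambda>w. C * sqrt (w $ 3)) \<longlongrightarrow> 0) (at v within P)"
        using True by simp
      have "norm (h_map w) \<le> C * sqrt (w $ 3)" if "w \<in> P" for w
      proof -
        have w: "cmod (proj w) \<le> C * w $ 3" "w $ 3 \<ge> 0"
          using bound[OF that] assms(1) by (auto, smt (verit) norm_ge_zero zero_le_mult_iff)
        then have "norm (h_map w) = cmod (proj w) / sqrt (w $ 3)"
          by (simp add: h_map_proj)
        also have "\<dots> \<le> (C * w $ 3) / sqrt (w $ 3)"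
          using w by (intro divide_right_mono) auto
        also have "\<dots> = C * sqrt (w $ 3)"
          using w(2) by (simp add: real_div_sqrt flip: times_divide_eq_right)
        finally show ?thesis .
      qed
      then show "\<forall>\<^sub>F w in at v within P. norm (h_map w) \<le> C * sqrt (w $ 3)"
        by (simp add: eventually_at_filter)
    qed
    moreover have "h_map v = 0"
      using True by (simp add: h_map_proj)
    ultimately show ?thesis
      by (simp add: continuous_within)
  qed
qed

lemma connected_unbounded_in_outside:
  assumes "connected T" "\<not> bounded T" "T \<inter> S = {}" "x \<in> T"
  shows "x \<in> outside S"
proof -
  have "T \<subseteq> connected_component_set (- S) x"
    using assms by (intro connected_component_maximal) auto
  then show ?thesis
    using assms bounded_subset by (auto simp: outside_def)
qed

lemma unbounded_ray:
  fixes a :: "'a::real_normed_vector"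
  assumes "a \<noteq> 0"
  shows "\<not> bounded ((\<lambda>t. t *\<^sub>R a) ` {c..})"
proof
  assume "bounded ((\<lambda>t. t *\<^sub>R a) ` {c..})"
  then obtain B where B: "\<And>t. t \<ge> c \<Longrightarrow> norm (t *\<^sub>R a) \<le> B"
    by (auto simp: bounded_iff)
  define t where "t = max c ((\<bar>B\<bar> + 1) / norm a)"
  have t: "t \<ge> (\<bar>B\<bar> + 1) / norm a" "t \<ge> c" by (auto simp: t_def)
  moreover have "(\<bar>B\<bar> + 1) / norm a \<ge> 0" by simp
  ultimately have "t \<ge> 0" by linarith
  moreover have "t * norm a \<ge> \<bar>B\<bar> + 1"
    using t(1) assms by (simp add: field_simps)
  ultimately show False using B[OF t(2)] by simp
qed

lemma connected_ray: "connected ((\<lambda>t. t *\<^sub>R a) ` {c..})" for a :: "'a::real_normed_vector"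
  by (intro connected_continuous_image continuous_intros) auto

text \<open>The segment between two points over a line through \<open>0\<close> stays over that line, so its image is
  a connected part of the line and contains every point between the images of the ends.\<close>

lemma h_image_radially_convex:
  assumes "convex P" "C > 0" and bound: "\<And>v. v \<in> P \<Longrightarrow> cmod (proj v) \<le> C * v $ 3"
    and "s *\<^sub>R z \<in> h_map ` P" "t *\<^sub>R z \<in> h_map ` P" "s \<le> 1" "1 \<le> t"
  shows "z \<in> h_map ` P"
proof (cases "z = 0")
  case True
  then show ?thesis using assms by auto
next
  case False
  have cont: "continuous_on P h_map"
    using continuous_on_h_map assms(2) bound by blast
  have pr: "proj v = sqrt (v $ 3) *\<^sub>R h_map v" if "v \<in> P" for v
    using bound[OF that] by (cases "v $ 3 = 0") (auto simp: h_map_proj)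
  obtain v w where vw: "v \<in> P" "h_map v = s *\<^sub>R z" "w \<in> P" "h_map w = t *\<^sub>R z"
    using assms(4,5) by (metis imageE)
  \<comment> \<open>the segment joining the two preimages\<close>
  define \<gamma> where "\<gamma> r = (1 - r) *\<^sub>R v + r *\<^sub>R w" for r
  have \<gamma>P: "\<gamma> r \<in> P" if "r \<in> {0..1}" for r
    using that vw \<open>convex P\<close> by (auto simp: \<gamma>_def convex_alt)
  have radial: "\<exists>f. h_map (\<gamma> r) = f *\<^sub>R z" for r
  proof -
    have "proj (\<gamma> r) = (1 - r) *\<^sub>R proj v + r *\<^sub>R proj w"
      unfolding \<gamma>_def by (simp only: linear_add[OF linear_proj] linear_cmul[OF linear_proj])
    also have "\<dots> = ((1 - r) * sqrt (v $ 3) * s + r * sqrt (w $ 3) * t) *\<^sub>R z"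
      using vw pr by (simp add: scaleR_add_left mult.assoc)
    finally have "proj (\<gamma> r) = ((1 - r) * sqrt (v $ 3) * s + r * sqrt (w $ 3) * t) *\<^sub>R z" .
    then show ?thesis
      by (auto simp: h_map_proj)
  qed
  have "continuous_on {0..1} (\<lambda>r. z \<bullet> h_map (\<gamma> r))"
    using \<gamma>P unfolding \<gamma>_def
    by (intro continuous_intros continuous_on_compose2[OF cont]) auto
  moreover have "z \<bullet> h_map (\<gamma> 0) \<le> z \<bullet> z" "z \<bullet> z \<le> z \<bullet> h_map (\<gamma> 1)"
    using vw mult_right_mono[OF assms(6) inner_ge_zero[of z]]
      mult_right_mono[OF assms(7) inner_ge_zero[of z]] by (auto simp: \<gamma>_def)
  ultimately obtain r where r: "0 \<le> r" "r \<le> 1" "z \<bullet> h_map (\<gamma> r) = z \<bullet> z"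
    using IVT'[of "\<lambda>r. z \<bullet> h_map (\<gamma> r)" 0 "z \<bullet> z" 1] by auto
  obtain f where "h_map (\<gamma> r) = f *\<^sub>R z"
    using radial by blast
  with r(3) False have "h_map (\<gamma> r) = z" by simp
  then show ?thesis
    using \<gamma>P r by (metis atLeastAtMost_iff image_eqI)
qed

text \<open>A point \<open>z\<close> off the image escapes to infinity along its own ray, unless that ray meets the image
  further out.  In that case the way from \<open>z\<close> inward to \<open>0\<close> is free by radial convexity, so
  \<open>0\<close> is not in the convex compact set of all \<open>proj v\<close>; a separating normal \<open>a\<close> satisfies
  \<open>a \<bullet> h_map v > 0\<close> on \<open>P\<close>, and the ray from \<open>0\<close> in direction \<open>- a\<close> is free.\<close>

lemma inside_h_image_empty:
  assumes "convex P" "compact P" "C > 0" and bound: "\<And>v. v \<in> P \<Longrightarrow> cmod (proj v) \<le> C * v $ 3"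
  shows "inside (h_map ` P) = {}"
proof -
  have "z \<in> outside (h_map ` P)" if z: "z \<notin> h_map ` P" for z
  proof (cases "P = {}")
    case True
    then show ?thesis by simp
  next
    case False
    have escape: "z \<in> outside (h_map ` P)" if 0: "0 \<notin> h_map ` P" and
      inward: "\<And>t. 0 \<le> t \<Longrightarrow> t \<le> 1 \<Longrightarrow> t *\<^sub>R z \<notin> h_map ` P"
    proof -
      have "0 \<notin> proj ` P"
        using 0 by (force simp: h_map_proj)
      moreover have "convex (proj ` P)" "compact (proj ` P)"
        using assms(1,2) linear_proj continuous_on_proj
        by (auto intro: convex_linear_image compact_continuous_image)
      ultimately obtain a b where a: "a \<noteq> 0" "0 < b" "\<And>x. x \<in> proj ` P \<Longrightarrow> a \<bullet> x > b"
        using separating_hyperplane_closed_0_inset[of "proj ` P"] False compact_imp_closed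
        by (metis image_is_empty)
      let ?T = "closed_segment 0 z \<union> (\<lambda>t. t *\<^sub>R (- a)) ` {0..}"
      have "0 \<in> closed_segment 0 z \<inter> (\<lambda>t. t *\<^sub>R (- a)) ` {0..}"
        by (auto intro!: image_eqI[of _ _ 0])
      then have "connected ?T"
        by (intro connected_Un connected_ray) auto
      moreover have "\<not> bounded ?T"
        using unbounded_ray[of "- a" 0] a by (simp add: bounded_Un)
      moreover have "?T \<inter> h_map ` P = {}"
      proof -
        have "closed_segment 0 z \<inter> h_map ` P = {}"
          using inward by (force simp: in_segment)
        have pos: "a \<bullet> h_map v > 0" if "v \<in> P" for v
        proof -
          have "v $ 3 \<ge> 0"
            using bound[OF that] assms(3) by (smt (verit) norm_ge_zero zero_le_mult_iff)
          moreover have "v $ 3 \<noteq> 0"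
            using 0 that by (metis h_map_proj division_ring_divide_zero imageI real_sqrt_zero scaleR_zero_left)
          ultimately show ?thesis
            using a(2) a(3)[of "proj v"] that by (simp add: h_map_proj)
        qed
        have "x \<notin> (\<lambda>t. t *\<^sub>R (- a)) ` {0..}" if "x \<in> h_map ` P" for x
        proof
          assume "x \<in> (\<lambda>t. t *\<^sub>R (- a)) ` {0..}"
          then have "a \<bullet> x \<le> 0" by auto
          with that pos show False
            by (metis imageE not_le)
        qed
        with \<open>closed_segment 0 z \<inter> h_map ` P = {}\<close> show ?thesis by blast
      qed
      ultimately show ?thesis
        by (intro connected_unbounded_in_outside[of ?T]) auto
    qed
    show ?thesis
    proof (cases "\<exists>t\<ge>1. t *\<^sub>R z \<in> h_map ` P")
      case True
      then obtain t where t: "t \<ge> 1" "t *\<^sub>R z \<in> h_map ` P" by blast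
      have inward: "s *\<^sub>R z \<notin> h_map ` P" if "s \<le> 1" for s
        using h_image_radially_convex[OF assms(1,3) bound _ t(2) that t(1)] z by blast
      from inward[of 0] show ?thesis
        using inward by (intro escape) auto
    next
      case outward: False
      show ?thesis
      proof (cases "z = 0")
        case True
        then show ?thesis using z by (intro escape) auto
      next
        case False
        have "(\<lambda>t. t *\<^sub>R z) ` {1..} \<inter> h_map ` P = {}"
          using outward by blast
        with False show ?thesis
          using unbounded_ray[of z 1] connected_ray[of z 1]
          by (intro connected_unbounded_in_outside[of "(\<lambda>t. t *\<^sub>R z) ` {1..}"])
            (auto intro!: image_eqI[of _ _ 1])
      qed
    qed
  qed
  then show ?thesis
    by (auto simp: inside_outside)
qed

text \<open>A component of the complement of \<open>K\<close> that meets \<open>F\<close> cannot cross the frontier of \<open>F\<close>, so it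
  stays in the bounded set \<open>F\<close>; conversely, a point off \<open>F\<close> reaches infinity without meeting \<open>F\<close>,
  let alone \<open>K\<close>.\<close>

lemma enclosed_by_frontier:
  fixes F :: "'a::euclidean_space set"
  assumes "bounded F" "inside F = {}" "K \<subseteq> F" "frontier F \<subseteq> K"
  shows "K \<union> inside K = F"
proof (intro equalityI subsetI)
  fix x assume "x \<in> K \<union> inside K"
  moreover have "x \<notin> inside K" if "x \<notin> F"
    using that assms(2) outside_mono[OF assms(3)] outside_inside[of F] inside_Int_outside[of K] by blast
  ultimately show "x \<in> F" using assms(3) by blast
next
  fix x assume x: "x \<in> F"
  show "x \<in> K \<union> inside K"
  proof (cases "x \<in> K")
    case False
    let ?C = "connected_component_set (- K) x"
    have "x \<in> ?C" using False by (simp add: connected_component_refl)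
    moreover have "?C \<inter> frontier F = {}"
      using assms(4) connected_component_subset[of "- K" x] by blast
    ultimately have "?C \<subseteq> F"
      using connected_Int_frontier[of ?C F] x connected_connected_component[of "- K" x] by blast
    then show ?thesis
      using False assms(1) bounded_subset by (auto simp: inside_def)
  qed simp
qed

lemma open_segment_DW_point_pos:
  assumes "l \<noteq> k" "v \<in> open_segment (DW_point l) (DW_point k)"
  shows "v $ 3 > 0"
proof -
  obtain t where t: "0 < t" "t < 1" "v = (1 - t) *\<^sub>R DW_point l + t *\<^sub>R DW_point k"
    using assms(2) by (auto simp: in_segment)
  have "0 < (1 - t) * (cmod l)\<^sup>2 + t * (cmod k)\<^sup>2"
    using t assms(1)
    by (cases "l = 0") (auto intro!: add_pos_nonneg)
  then show ?thesis using t by simp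
qed

text \<open>An end point at height \<open>0\<close> is missing from the arc, but it is a limit of points of
  the open segment, which have positive height.\<close>

lemma closure_h_map_segment:
  assumes "l \<noteq> k"
  shows "closure (h_map ` (closed_segment (DW_point l) (DW_point k) \<inter> {v. 0 < v $ 3})) =
    h_map ` closed_segment (DW_point l) (DW_point k)" (is "closure ?H = ?R")
proof
  obtain C where C: "C > 0"
    "\<And>v. v \<in> closed_segment (DW_point l) (DW_point k) \<Longrightarrow> cmod (proj v) \<le> C * v $ 3"
    using shell_linear_bound[of "{l, k}"] by (auto simp: segment_convex_hull)
  then have cont: "continuous_on (closed_segment (DW_point l) (DW_point k)) h_map"
    by (rule continuous_on_h_map)
  then have "closed ?R"
    by (intro compact_imp_closed compact_continuous_image) auto
  then show "closure ?H \<subseteq> ?R"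
    by (intro closure_minimal) auto
  have ne: "DW_point l \<noteq> DW_point k"
    using assms by (metis proj_DW_point)
  have "h_map ` closure (open_segment (DW_point l) (DW_point k)) \<subseteq> closure ?H"
  proof (rule image_closure_subset)
    show "h_map ` open_segment (DW_point l) (DW_point k) \<subseteq> closure ?H"
      using open_segment_DW_point_pos[OF assms] open_closed_segment
      by (intro subset_trans[OF _ closure_subset] image_mono) blast
  qed (use cont ne in auto)
  then show "?R \<subseteq> closure ?H"
    using ne by simp
qed

lemma rel_frontier_polygon:
  fixes P :: "'a::euclidean_space set"
  assumes "polytope P" "aff_dim P = 2"
  shows "rel_frontier P = \<Union>{e. e edge_of P}"
proof -
  have "F facet_of P \<longleftrightarrow> F edge_of P" for F
    using assms(2) by (auto simp: facet_of_def edge_of_def)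
  then show ?thesis
    using rel_frontier_of_polyhedron[OF polytope_imp_polyhedron[OF assms(1)]] by simp
qed

section \<open>Folding of \<open>h\<close> along the critical level of a plane\<close>

lemma inner_proj: "\<eta> \<bullet> v = proj \<eta> \<bullet> proj v + \<eta> $ 3 * v $ 3"
  by (simp add: proj_def inner_vec_def sum_3 inner_complex_def)

lemma proj_h_map: "0 < v $ 3 \<Longrightarrow> proj v = sqrt (v $ 3) *\<^sub>R h_map v"
  by (simp add: h_map_proj)

text \<open>With \<open>z = h_map v\<close> and \<open>x = proj \<eta> \<bullet> z\<close>, the square roots of the heights of both points solve
  \<open>\<eta>\<^sub>3 s\<^sup>2 + x s = b\<close>.  Equal heights would force equal points, so these are the two
  roots, and \<open>b\<close> is their product up to the factor \<open>- \<eta>\<^sub>3\<close>.\<close>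

lemma plane_fibre:
  assumes "\<eta> \<bullet> v = b" "\<eta> \<bullet> w = b" "0 < v $ 3" "0 < w $ 3" "h_map v = h_map w" "v \<noteq> w"
  shows "sqrt (v $ 3) \<noteq> sqrt (w $ 3)" "b = - \<eta> $ 3 * (sqrt (v $ 3) * sqrt (w $ 3))"
proof -
  define s where "s = sqrt (v $ 3)"
  define t where "t = sqrt (w $ 3)"
  define x where "x = proj \<eta> \<bullet> h_map v"
  have st: "s > 0" "t > 0" "v $ 3 = s\<^sup>2" "w $ 3 = t\<^sup>2"
    using assms by (auto simp: s_def t_def)
  show ne: "sqrt (v $ 3) \<noteq> sqrt (w $ 3)"
    using assms proj_h_map[of v] proj_h_map[of w] proj_eqI[of v w] by auto
  have 1: "x * s + \<eta> $ 3 * s\<^sup>2 = b"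
    using assms(1) proj_h_map[OF assms(3)] st
    by (simp add: inner_proj x_def mult.commute flip: s_def)
  have 2: "x * t + \<eta> $ 3 * t\<^sup>2 = b"
    using assms(2) proj_h_map[OF assms(4)] st
    by (simp add: inner_proj x_def assms(5) mult.commute flip: t_def)
  have "(s - t) * (x + \<eta> $ 3 * (s + t)) = 0"
    using 1 2 by (simp add: algebra_simps power2_eq_square)
  then have "x = - \<eta> $ 3 * (s + t)"
    using ne by (simp add: s_def t_def)
  with 1 show "b = - \<eta> $ 3 * (sqrt (v $ 3) * sqrt (w $ 3))"
    unfolding s_def[symmetric] t_def[symmetric] by (simp add: algebra_simps power2_eq_square)
qed

text \<open>Two distinct points with one image have heights whose square roots multiply to the critical
  level, so they lie strictly on different sides of it.  In a vertical plane off the origin there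
  are no such pairs.\<close>

lemma inj_on_h_map_one_sided:
  assumes P: "P \<subseteq> {v. \<eta> \<bullet> v = b}" and nondeg: "\<eta> $ 3 \<noteq> 0 \<or> b \<noteq> 0"
    and side: "\<And>\<alpha>. \<eta> $ 3 \<noteq> 0 \<Longrightarrow> b + \<alpha> * \<eta> $ 3 = 0 \<Longrightarrow>
      (\<forall>v\<in>P. \<alpha> \<le> v $ 3) \<or> (\<forall>v\<in>P. v $ 3 \<le> \<alpha>)"
  shows "inj_on h_map (P \<inter> {v. 0 < v $ 3})"
proof (rule inj_onI, rule ccontr)
  fix v w assume vw: "v \<in> P \<inter> {v. 0 < v $ 3}" "w \<in> P \<inter> {v. 0 < v $ 3}" "h_map v = h_map w" "v \<noteq> w"
  define s where "s = sqrt (v $ 3)"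
  define t where "t = sqrt (w $ 3)"
  have st: "s > 0" "t > 0" "v $ 3 = s\<^sup>2" "w $ 3 = t\<^sup>2"
    using vw by (auto simp: s_def t_def)
  have ne: "s \<noteq> t" and b: "b = - \<eta> $ 3 * (s * t)"
    using plane_fibre[of \<eta> v b w] vw P by (auto simp: s_def t_def)
  with nondeg have "\<eta> $ 3 \<noteq> 0" by auto
  moreover have "b + s * t * \<eta> $ 3 = 0"
    using b by simp
  ultimately have "(\<forall>v\<in>P. s * t \<le> v $ 3) \<or> (\<forall>v\<in>P. v $ 3 \<le> s * t)"
    by (rule side)
  then have "(s * t \<le> s * s \<and> s * t \<le> t * t) \<or> (s * s \<le> s * t \<and> t * t \<le> s * t)"
    using vw(1,2) st(3,4) by (metis IntD1 power2_eq_square)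
  then have "s = t"
    using st(1,2) by auto
  with ne show False by simp
qed

lemma h_map_interior:
  fixes P :: "(real ^ 3) set"
  assumes "aff_dim P = 2" "continuous_on P h_map" "open T"
    and inj: "inj_on h_map (P \<inter> {v. 0 < v $ 3} \<inter> T)"
    and v: "v \<in> rel_interior P" "0 < v $ 3" "v \<in> T"
  shows "h_map v \<in> interior (h_map ` (P \<inter> {v. 0 < v $ 3}))"
proof -
  let ?U = "rel_interior P \<inter> ({v. 0 < v $ 3} \<inter> T)"
  have "open ({v :: real ^ 3. 0 < v $ 3} \<inter> T)"
    using \<open>open T\<close> by (intro open_Int open_Collect_less continuous_intros)
  then have U: "openin (top_of_set (affine hull P)) ?U"
    by (intro openin_Int_open openin_rel_interior)
  have sub: "?U \<subseteq> P \<inter> {v. 0 < v $ 3} \<inter> T"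
    using rel_interior_subset by blast
  have "openin (top_of_set UNIV) (h_map ` ?U)"
  proof (rule invariance_of_domain_affine_sets[OF U])
    show "aff_dim (UNIV :: complex set) \<le> aff_dim (affine hull P)"
      using assms(1) by simp
    show "continuous_on ?U h_map"
      using assms(2) sub continuous_on_subset by blast
    show "inj_on h_map ?U"
      using inj sub inj_on_subset by blast
  qed auto
  then have "open (h_map ` ?U)" by simp
  then show ?thesis
    using sub v by (intro interiorI[of "h_map ` ?U"]) auto
qed

lemma affine_hull_eq_plane:
  fixes P :: "(real ^ 3) set"
  assumes "aff_dim P = 2" "\<eta> \<noteq> 0" "P \<subseteq> {v. \<eta> \<bullet> v = b}"
  shows "affine hull P = {v. \<eta> \<bullet> v = b}"
proof (rule affine_dim_equal)
  show "affine hull P \<noteq> {}"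
    using assms(1) by (auto simp: aff_dim_empty)
  show "affine hull P \<subseteq> {v. \<eta> \<bullet> v = b}"
    using assms(3) by (intro hull_minimal affine_hyperplane)
qed (use assms in \<open>auto simp: affine_hyperplane\<close>)

text \<open>In a vertical plane through the origin the whole curve \<open>s \<mapsto> (s z, s\<^sup>2)\<close> lies in the plane, and
  its image for \<open>s > 0\<close> is the single point \<open>z\<close>.  Its last point in the bounded set \<open>P\<close> is a relative
  boundary point.\<close>

lemma h_map_rel_frontier_vertical:
  fixes P :: "(real ^ 3) set"
  assumes hull: "affine hull P = {v. \<eta> \<bullet> v = 0}" and "\<eta> $ 3 = 0"
    and "compact P" and v: "v \<in> P" "0 < v $ 3"
  shows "h_map v \<in> h_map ` rel_frontier P"
proof -
  define z where "z = h_map v"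
  define c :: "real \<Rightarrow> real ^ 3" where "c s = s *\<^sub>R vector [Re z, Im z, 0] + s\<^sup>2 *\<^sub>R axis 3 1" for s
  have pc: "proj (c s) = s *\<^sub>R z" for s
    by (simp add: c_def proj_def complex_eq_iff axis_def)
  have c3: "c s $ 3 = s\<^sup>2" for s by (simp add: c_def axis_def)
  have v_c: "v = c (sqrt (v $ 3))"
    using v by (intro proj_eqI) (simp_all add: pc c3 z_def proj_h_map)
  have "\<eta> \<bullet> v = 0"
    using hull v hull_subset[of P affine] by auto
  then have "proj \<eta> \<bullet> z = 0"
    using assms(2) v by (simp add: inner_proj z_def h_map_proj)
  then have plane: "c s \<in> affine hull P" for s
    using assms(2) by (simp add: hull inner_proj pc)
  have cont: "continuous_on UNIV c"
    unfolding c_def by (intro continuous_intros)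
  define T where "T = {s. c s \<in> P}"
  have "closed T"
    using closed_vimage[OF compact_imp_closed[OF \<open>compact P\<close>] cont]
    by (simp add: T_def vimage_def)
  moreover have "bounded T"
  proof -
    obtain B where B: "\<And>x. x \<in> P \<Longrightarrow> norm x \<le> B"
      using compact_imp_bounded[OF \<open>compact P\<close>] by (auto simp: bounded_iff)
    have "norm s \<le> B + 1" if "s \<in> T" for s
    proof -
      have "s\<^sup>2 \<le> norm (c s)"
        using component_le_norm_cart[of "c s" 3] by (simp add: c3)
      with B[of "c s"] that have "s\<^sup>2 \<le> B" by (simp add: T_def)
      moreover have "\<bar>s\<bar> \<le> s\<^sup>2 + 1"
        using zero_le_power2[of "\<bar>s\<bar> - 1"] by (simp add: power2_eq_square algebra_simps)
      ultimately show ?thesis by simp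
    qed
    then show ?thesis by (auto simp: bounded_iff)
  qed
  moreover have "sqrt (v $ 3) \<in> T"
    using v v_c by (simp add: T_def)
  ultimately obtain s where s: "s \<in> T" "\<And>t. t \<in> T \<Longrightarrow> t \<le> s"
    using compact_attains_sup[of T] by (auto simp: compact_eq_bounded_closed)
  have "s > 0"
    using s(2)[OF \<open>sqrt (v $ 3) \<in> T\<close>] v(2) by (smt (verit) real_sqrt_gt_zero)
  have "c s \<notin> rel_interior P"
  proof
    assume "c s \<in> rel_interior P"
    then obtain e where e: "e > 0" "ball (c s) e \<inter> affine hull P \<subseteq> P"
      by (auto simp: mem_rel_interior_ball)
    have "isCont c s"
      using cont by (simp add: continuous_on_eq_continuous_at)
    then obtain d where d: "d > 0" "\<And>t. dist t s < d \<Longrightarrow> dist (c t) (c s) < e"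
      using e(1) by (auto simp: continuous_at_eps_delta)
    have "c (s + d/2) \<in> P"
      using e(2) d(2)[of "s + d/2"] plane d(1) by (auto simp: dist_commute dist_real_def)
    then show False
      using s(2)[of "s + d/2"] d(1) by (simp add: T_def)
  qed
  then have "c s \<in> rel_frontier P"
    using s(1) closure_subset by (auto simp: rel_frontier_def T_def)
  moreover have "h_map (c s) = z"
    using \<open>s > 0\<close> by (simp add: h_map_proj pc c3)
  ultimately show ?thesis
    by (metis z_def image_eqI)
qed

text \<open>The level cuts the plane in a line, so it cuts \<open>P\<close> in a segment, which is nondegenerate since
  it contains a relative interior point of \<open>P\<close>.  Taking the relative interior commutes with
  this intersection.\<close>

lemma level_chord:
  fixes P :: "(real ^ 3) set"
  assumes "convex P" "compact P" and hull: "affine hull P = {v. \<eta> \<bullet> v = b}"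
    and "proj \<eta> \<noteq> 0" and c: "c \<in> rel_interior P" "c $ 3 = \<alpha>"
  obtains p q where "p \<noteq> q" "P \<inter> {v. v $ 3 = \<alpha>} = closed_segment p q"
    "rel_frontier P \<inter> {v. v $ 3 = \<alpha>} = {p, q}"
proof -
  let ?H = "{v :: real ^ 3. v $ 3 = \<alpha>}"
  \<comment> \<open>a direction vector of the line in which the level meets the plane\<close>
  define u :: "real ^ 3" where "u = vector [- \<eta> $ 2, \<eta> $ 1, 0]"
  define n where "n = (\<eta> $ 1)\<^sup>2 + (\<eta> $ 2)\<^sup>2"
  have n: "n > 0"
    using assms(4) by (auto simp: n_def proj_def complex_eq_iff sum_power2_gt_zero_iff)
  have "u \<noteq> 0"
    using n by (auto simp: u_def vec_eq_iff forall_3 n_def)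
  have \<eta>u: "\<eta> \<bullet> u = 0"
    by (simp add: u_def inner_vec_def sum_3)
  have "?H = {v. axis 3 1 \<bullet> v = \<alpha>}"
    by (simp add: inner_axis' )
  then have "affine ?H"
    by (simp add: affine_hyperplane)
  have cP: "c \<in> P" using c rel_interior_subset by blast
  have sub: "P \<subseteq> {v. \<eta> \<bullet> v = b}" using hull hull_subset[of P affine] by simp
  have "collinear (P \<inter> ?H)"
    unfolding collinear_def
  proof (intro exI[of _ u] ballI)
    fix x y assume xy: "x \<in> P \<inter> ?H" "y \<in> P \<inter> ?H"
    let ?p = "x $ 1 - y $ 1" and ?q = "x $ 2 - y $ 2"
    have "\<eta> \<bullet> x = \<eta> \<bullet> y" "x $ 3 = y $ 3"
      using xy sub by auto
    then have 0: "\<eta> $ 1 * ?p + \<eta> $ 2 * ?q = 0"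
      by (simp add: inner_vec_def sum_3 algebra_simps)
    have "?p * n = (\<eta> $ 1 * ?q - \<eta> $ 2 * ?p) * (- \<eta> $ 2) + \<eta> $ 1 * (\<eta> $ 1 * ?p + \<eta> $ 2 * ?q)"
      "?q * n = (\<eta> $ 1 * ?q - \<eta> $ 2 * ?p) * (\<eta> $ 1) + \<eta> $ 2 * (\<eta> $ 1 * ?p + \<eta> $ 2 * ?q)"
      unfolding n_def by (simp_all add: algebra_simps power2_eq_square)
    then have "x - y = ((\<eta> $ 1 * ?q - \<eta> $ 2 * ?p) / n) *\<^sub>R u"
      using n \<open>x $ 3 = y $ 3\<close> unfolding 0
      by (simp add: vec_eq_iff forall_3 u_def field_simps)
    then show "\<exists>k. x - y = k *\<^sub>R u" ..
  qed
  moreover have "closed ?H"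
    by (intro closed_Collect_eq continuous_intros)
  then have "compact (P \<inter> ?H)"
    using \<open>compact P\<close> by (intro compact_Int_closed)
  moreover have "convex (P \<inter> ?H)"
    using \<open>convex P\<close> \<open>affine ?H\<close> affine_imp_convex by (intro convex_Int) auto
  moreover have cH: "c \<in> P \<inter> ?H" using cP c by simp
  ultimately obtain p q where pq: "P \<inter> ?H = closed_segment p q"
    by (metis compact_convex_collinear_segment empty_iff)
  have "p \<noteq> q"
  proof
    assume "p = q"
    then have single: "P \<inter> ?H = {c}"
      using pq cH by auto
    obtain e where e: "e > 0" "cball c e \<inter> affine hull P \<subseteq> P"
      using c(1) by (auto simp: mem_rel_interior_cball)
    let ?v = "c + (e / norm u) *\<^sub>R u"
    have "?v \<in> cball c e"
      using e(1) by (simp add: dist_norm)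
    moreover have "?v \<in> affine hull P"
      using \<eta>u cP sub by (auto simp: hull inner_add_right)
    ultimately have "?v \<in> P \<inter> ?H"
      using e(2) c(2) by (auto simp: u_def)
    then show False
      using single \<open>u \<noteq> 0\<close> e(1) by simp
  qed
  have "rel_frontier P \<inter> ?H = P \<inter> ?H - rel_interior P \<inter> ?H"
    using compact_imp_closed[OF \<open>compact P\<close>] by (auto simp: rel_frontier_def)
  also have "rel_interior P \<inter> ?H = rel_interior (P \<inter> ?H)"
    using c \<open>convex P\<close> \<open>affine ?H\<close> by (subst convex_affine_rel_interior_Int) auto
  also have "P \<inter> ?H - rel_interior (P \<inter> ?H) = {p, q}"
    unfolding pq rel_interior_closed_segment using \<open>p \<noteq> q\<close> by (auto simp: open_segment_def)
  finally show thesis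
    using that \<open>p \<noteq> q\<close> pq by blast
qed

lemma rel_interior_meets_level:
  fixes P :: "(real ^ 3) set"
  assumes "convex P" "v \<in> P" "v $ 3 < \<alpha>" "w \<in> P" "\<alpha> < w $ 3"
  obtains c where "c \<in> rel_interior P" "c $ 3 = \<alpha>"
proof -
  note result = that
  have cross: thesis if "c \<in> rel_interior P" "y \<in> P" "(c $ 3 - \<alpha>) * (y $ 3 - \<alpha>) < 0" for c y
  proof -
    define t where "t = (\<alpha> - c $ 3) / (y $ 3 - c $ 3)"
    have ne: "y $ 3 - c $ 3 \<noteq> 0" using that(3) by (auto simp: not_less)
    have t: "0 < t" "t < 1"
      using that(3) by (auto simp: t_def mult_less_0_iff divide_simps)
    have "c \<noteq> y" using ne by auto
    then have "(1 - t) *\<^sub>R c + t *\<^sub>R y \<in> open_segment c y"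
      using t by (auto simp: in_segment)
    also have "\<dots> \<subseteq> rel_interior P"
      using that assms(1) closure_subset by (intro rel_interior_closure_convex_segment) auto
    finally have "(1 - t) *\<^sub>R c + t *\<^sub>R y \<in> rel_interior P" .
    moreover have "((1 - t) *\<^sub>R c + t *\<^sub>R y) $ 3 = c $ 3 + t * (y $ 3 - c $ 3)"
      by (simp add: algebra_simps)
    then have "((1 - t) *\<^sub>R c + t *\<^sub>R y) $ 3 = \<alpha>"
      using ne by (simp add: t_def)
    ultimately show thesis by (rule result)
  qed
  obtain c where c: "c \<in> rel_interior P"
    using assms(1,2) rel_interior_eq_empty by fastforce
  consider "c $ 3 = \<alpha>" | "c $ 3 < \<alpha>" | "c $ 3 > \<alpha>" by linarith
  then show thesis
    by cases (use c cross[OF c assms(2)] cross[OF c assms(4)] result assms in \<open>auto simp: mult_less_0_iff\<close>)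
qed

lemma sqrt_level_bound:
  assumes "0 < \<alpha>" "0 < (u::real)"
  shows "2 * sqrt \<alpha> \<le> (u + \<alpha>) / sqrt u" "(u + \<alpha>) / sqrt u = 2 * sqrt \<alpha> \<longleftrightarrow> u = \<alpha>"
proof -
  have eq: "(u + \<alpha>) - 2 * sqrt \<alpha> * sqrt u = (sqrt u - sqrt \<alpha>)\<^sup>2"
    using assms by (simp add: power2_diff)
  have "0 \<le> (u + \<alpha>) - 2 * sqrt \<alpha> * sqrt u"
    unfolding eq by simp
  then show "2 * sqrt \<alpha> \<le> (u + \<alpha>) / sqrt u"
    using assms by (simp add: pos_le_divide_eq)
  have "(u + \<alpha>) / sqrt u = 2 * sqrt \<alpha> \<longleftrightarrow> (sqrt u - sqrt \<alpha>)\<^sup>2 = 0"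
    using assms by (simp add: divide_eq_eq flip: eq)
  then show "(u + \<alpha>) / sqrt u = 2 * sqrt \<alpha> \<longleftrightarrow> u = \<alpha>" by simp
qed

lemma arc_param_derivative:
  assumes pos: "0 < ((1 - t) *\<^sub>R DW_point l + t *\<^sub>R DW_point k) $ 3" (is "0 < ?u")
  obtains d where "(arc_param l k has_vector_derivative d) (at t within T)"
    "d = (1 / sqrt ?u) *\<^sub>R (k - l) - (((cmod k)\<^sup>2 - (cmod l)\<^sup>2) / (2 * ?u * sqrt ?u)) *\<^sub>R ((1 - t) *\<^sub>R l + t *\<^sub>R k)"
proof -
  define u where "u s = (1 - s) * (cmod l)\<^sup>2 + s * (cmod k)\<^sup>2" for s
  have ut: "u t > 0" "?u = u t" using pos by (auto simp: u_def)
  have arc: "arc_param l k = (\<lambda>s. (1 / sqrt (u s)) *\<^sub>R ((1 - s) *\<^sub>R l + s *\<^sub>R k))"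
    by (simp add: fun_eq_iff arc_param_def h_map_proj u_def linear_add[OF linear_proj] linear_cmul[OF linear_proj])
  define u' where "u' = (cmod k)\<^sup>2 - (cmod l)\<^sup>2"
  have "(u has_real_derivative u') (at t within T)"
    unfolding u_def u'_def by (auto intro!: derivative_eq_intros)
  then have "((\<lambda>s. sqrt (u s)) has_real_derivative inverse (sqrt (u t)) / 2 * u') (at t within T)"
    using ut(1) by (intro DERIV_chain2[OF DERIV_real_sqrt])
  then have "((\<lambda>s. inverse (sqrt (u s))) has_real_derivative
      - (inverse (sqrt (u t)) * (inverse (sqrt (u t)) / 2 * u') * inverse (sqrt (u t)))) (at t within T)"
    using ut(1) by (intro DERIV_inverse') auto
  moreover have "- (inverse (sqrt (u t)) * (inverse (sqrt (u t)) / 2 * u') * inverse (sqrt (u t))) =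
      - u' / (2 * (sqrt (u t) * sqrt (u t)) * sqrt (u t))"
    using ut(1) by (simp add: divide_simps del: real_sqrt_mult_self)
  moreover have "sqrt (u t) * sqrt (u t) = u t"
    using ut(1) by simp
  ultimately have "((\<lambda>s. 1 / sqrt (u s)) has_real_derivative - u' / (2 * u t * sqrt (u t))) (at t within T)"
    by (simp only: inverse_eq_divide)
  moreover have "((\<lambda>s. (1 - s) *\<^sub>R l + s *\<^sub>R k) has_vector_derivative (k - l)) (at t within T)"
    by (auto intro!: derivative_eq_intros)
  ultimately have "(arc_param l k has_vector_derivative
      (1 / sqrt (u t)) *\<^sub>R (k - l) + (- u' / (2 * u t * sqrt (u t))) *\<^sub>R ((1 - t) *\<^sub>R l + t *\<^sub>R k))
      (at t within T)"
    unfolding arc by (rule has_vector_derivative_scaleR)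
  then have "(arc_param l k has_vector_derivative
      (1 / sqrt (u t)) *\<^sub>R (k - l) - (u' / (2 * u t * sqrt (u t))) *\<^sub>R ((1 - t) *\<^sub>R l + t *\<^sub>R k))
      (at t within T)"
    by simp
  then show thesis
    by (rule that) (simp only: ut(2) u'_def)
qed

lemma shell_level_bounds:
  assumes "v \<in> convex hull (DW_point ` \<sigma>)"
  shows "(\<And>k. k \<in> \<sigma> \<Longrightarrow> c \<le> (cmod k)\<^sup>2) \<Longrightarrow> c \<le> v $ 3"
    and "(\<And>k. k \<in> \<sigma> \<Longrightarrow> (cmod k)\<^sup>2 \<le> c) \<Longrightarrow> v $ 3 \<le> c"
proof -
  have "convex hull (DW_point ` \<sigma>) \<subseteq> {v. axis 3 1 \<bullet> v \<ge> c}" if "\<And>k. k \<in> \<sigma> \<Longrightarrow> c \<le> (cmod k)\<^sup>2"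
    using that by (intro hull_minimal convex_halfspace_ge) (auto simp: inner_axis')
  then show "c \<le> v $ 3" if "\<And>k. k \<in> \<sigma> \<Longrightarrow> c \<le> (cmod k)\<^sup>2"
    using that assms by (auto simp: inner_axis')
  have "convex hull (DW_point ` \<sigma>) \<subseteq> {v. axis 3 1 \<bullet> v \<le> c}" if "\<And>k. k \<in> \<sigma> \<Longrightarrow> (cmod k)\<^sup>2 \<le> c"
    using that by (intro hull_minimal convex_halfspace_le) (auto simp: inner_axis')
  then show "v $ 3 \<le> c" if "\<And>k. k \<in> \<sigma> \<Longrightarrow> (cmod k)\<^sup>2 \<le> c"
    using that assms by (auto simp: inner_axis')
qed

text \<open>Along the arc, \<open>e \<bullet> _\<close> equals \<open>s + \<alpha> / s\<close> with \<open>s\<close> the square root of the height, and this is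
  stationary at \<open>s\<^sup>2 = \<alpha>\<close>.  So the velocity there is parallel to the line, even if it is zero.\<close>

lemma tangent_at_critical_level:
  assumes "\<alpha> > 0" and l: "e \<bullet> l = (cmod l)\<^sup>2 + \<alpha>" and k: "e \<bullet> k = (cmod k)\<^sup>2 + \<alpha>"
    and a: "a \<in> closed_segment (DW_point l) (DW_point k)" "a $ 3 = \<alpha>"
  shows "tangent_line_at (arc_param l k) {z. e \<bullet> z = 2 * sqrt \<alpha>} (h_map a)"
proof -
  obtain t where t: "0 \<le> t" "t \<le> 1" "a = (1 - t) *\<^sub>R DW_point l + t *\<^sub>R DW_point k"
    using a(1) by (auto simp: in_segment)
  then have level: "(1 - t) * (cmod l)\<^sup>2 + t * (cmod k)\<^sup>2 = \<alpha>"
    using a(2) by simp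
  have pa: "proj a = (1 - t) *\<^sub>R l + t *\<^sub>R k"
    unfolding t(3) by (simp only: linear_add[OF linear_proj] linear_cmul[OF linear_proj] proj_DW_point)
  have "e \<bullet> ((1 - t) *\<^sub>R l + t *\<^sub>R k) = (1 - t) * (e \<bullet> l) + t * (e \<bullet> k)"
    by (simp only: inner_add_right inner_scaleR_right)
  also have "\<dots> = ((1 - t) * (cmod l)\<^sup>2 + t * (cmod k)\<^sup>2) + \<alpha>"
    unfolding l k by (simp add: algebra_simps)
  finally have epa: "e \<bullet> ((1 - t) *\<^sub>R l + t *\<^sub>R k) = 2 * \<alpha>"
    by (simp add: level)
  obtain d where d: "(arc_param l k has_vector_derivative d) (at t within {0..1})"
    "d = (1 / sqrt \<alpha>) *\<^sub>R (k - l) -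
      (((cmod k)\<^sup>2 - (cmod l)\<^sup>2) / (2 * \<alpha> * sqrt \<alpha>)) *\<^sub>R ((1 - t) *\<^sub>R l + t *\<^sub>R k)"
    using arc_param_derivative[of t l k "{0..1}"] \<open>\<alpha> > 0\<close> unfolding a(2)[unfolded t(3)] by blast
  have "e \<bullet> d = (1 / sqrt \<alpha>) * (e \<bullet> k - e \<bullet> l) -
      (((cmod k)\<^sup>2 - (cmod l)\<^sup>2) / (2 * \<alpha> * sqrt \<alpha>)) * (2 * \<alpha>)"
    unfolding d(2) inner_diff_right inner_scaleR_right epa ..
  also have "\<dots> = 0"
    using \<open>\<alpha> > 0\<close> by (simp add: l k)
  finally have "e \<bullet> d = 0" .
  moreover have "e \<bullet> h_map a = 2 * sqrt \<alpha>"
    using \<open>\<alpha> > 0\<close> by (simp only: h_map_proj pa inner_scaleR_right epa a(2))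
      (simp add: real_div_sqrt flip: times_divide_eq_right)
  moreover have "arc_param l k t = h_map a"
    by (simp only: arc_param_def t(3))
  ultimately show ?thesis
    unfolding tangent_line_at_def using d(1) t(1,2)
    by (intro conjI bexI[of _ t] exI[of _ d]) (simp_all add: inner_add_right)
qed

section \<open>The image of a polygonal shell\<close>

text \<open>Below, \<open>P\<close> is the shell of a normal matrix with spectrum \<open>lam ` {1..m}\<close>, \<open>F\<close> is its normalized
  numerical range, and \<open>K\<close> is the closure of the union of its hyperbolic arcs (\<open>closure_arcs\<close>).\<close>

locale shell_polygon =
  fixes m :: nat and lam :: "nat \<Rightarrow> complex"
  assumes dim: "aff_dim (convex hull (DW_point ` lam ` {1..m})) = 2"
    and edges: "{e. e edge_of convex hull (DW_point ` lam ` {1..m})} =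
      (\<lambda>i. closed_segment (DW_point (lam i)) (DW_point (lam (i + 1)))) ` {1..m}"
begin

abbreviation P :: "(real ^ 3) set" where
  "P \<equiv> convex hull (DW_point ` lam ` {1..m})"

abbreviation F :: "complex set" where
  "F \<equiv> h_map ` (P \<inter> {v. 0 < v $ 3})"

abbreviation K :: "complex set" where
  "K \<equiv> h_map ` rel_frontier P"

abbreviation edge :: "nat \<Rightarrow> (real ^ 3) set" where
  "edge i \<equiv> closed_segment (DW_point (lam i)) (DW_point (lam (i + 1)))"

lemma compact_P: "compact P"
  by (intro compact_convex_hull finite_imp_compact) auto

lemma m_pos: "{1..m} \<noteq> {}"
proof
  assume "{1..m} = {}"
  then have "P = {}" by (simp only: image_empty convex_hull_empty)
  with dim show False by (simp only: aff_dim_empty_eq)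
qed

lemma linear_bound:
  obtains C where "C > 0" "\<And>v. v \<in> P \<Longrightarrow> cmod (proj v) \<le> C * v $ 3"
  using shell_linear_bound[of "lam ` {1..m}"] by blast

lemma continuous_on_P: "continuous_on P h_map"
  using linear_bound continuous_on_h_map by metis

lemma level_between:
  assumes "v \<in> P"
  shows "(MIN i\<in>{1..m}. (cmod (lam i))\<^sup>2) \<le> v $ 3" "v $ 3 \<le> (MAX i\<in>{1..m}. (cmod (lam i))\<^sup>2)"
  by (rule shell_level_bounds[OF assms]; auto)+

lemma nonneg_P: "v \<in> P \<Longrightarrow> 0 \<le> v $ 3"
  by (rule shell_level_bounds) auto

lemma zero_level:
  assumes "v \<in> P" "v $ 3 = 0"
  shows "v = 0" "0 \<in> lam ` {1..m}"
proof -
  obtain C where "C > 0" "cmod (proj v) \<le> C * v $ 3"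
    using linear_bound assms by metis
  then have "proj v = proj 0"
    using assms(2) by (simp add: linear_0[OF linear_proj])
  then show "v = 0"
    using assms(2) by (intro proj_eqI) auto
  have "(MIN i\<in>{1..m}. (cmod (lam i))\<^sup>2) \<in> (\<lambda>i. (cmod (lam i))\<^sup>2) ` {1..m}"
    using m_pos by (intro Min_in) auto
  then obtain i where "i \<in> {1..m}" "(cmod (lam i))\<^sup>2 \<le> 0"
    using level_between(1)[OF assms(1)] assms(2) by auto
  then show "0 \<in> lam ` {1..m}"
    by (metis image_eqI norm_eq_zero power2_less_eq_zero_iff)
qed

lemma rel_frontier_P: "rel_frontier P = (\<Union>i\<in>{1..m}. edge i)"
proof -
  have "polytope P" by (simp add: polytope_convex_hull)
  then show ?thesis
    using rel_frontier_polygon[OF _ dim] unfolding edges by blast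
qed

lemma edge_subset_rel_frontier: "i \<in> {1..m} \<Longrightarrow> edge i \<subseteq> rel_frontier P"
  unfolding rel_frontier_P by blast

lemma rel_frontier_subset_P: "rel_frontier P \<subseteq> P"
  using compact_imp_closed[OF compact_P] by (auto simp: rel_frontier_def)

lemma edge_endpoints_distinct:
  assumes "i \<in> {1..m}"
  shows "lam i \<noteq> lam (i + 1)"
proof
  assume "lam i = lam (i + 1)"
  moreover have "edge i edge_of P"
    using edges assms by blast
  ultimately show False by (auto simp: edge_of_def)
qed

lemma zero_in_K: "0 \<in> lam ` {1..m} \<Longrightarrow> 0 \<in> K"
proof -
  assume "0 \<in> lam ` {1..m}"
  then obtain i where "i \<in> {1..m}" "lam i = 0" by auto
  then have "DW_point 0 \<in> rel_frontier P"
    using edge_subset_rel_frontier[of i] by auto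
  moreover have "h_map (DW_point 0) = 0"
    by (simp add: h_map_proj)
  ultimately show ?thesis by (metis image_eqI)
qed

lemma closure_arcs: "closure (\<Union>(arcs m lam)) = K"
proof -
  have "closure (\<Union>i\<in>I. f i) = (\<Union>i\<in>I. closure (f i))" if "finite I"
    for I and f :: "nat \<Rightarrow> complex set"
    using that by (induction I) (simp_all add: closure_Un)
  then have "closure (\<Union>(arcs m lam)) = (\<Union>i\<in>{1..m}. closure (hyp_arc (lam i) (lam (i + 1))))"
    by (simp add: arcs_def)
  also have "\<dots> = (\<Union>i\<in>{1..m}. h_map ` edge i)"
    using edge_endpoints_distinct
    by (intro SUP_cong refl) (simp add: hyp_arc_h_map closure_h_map_segment)
  finally show ?thesis
    unfolding rel_frontier_P image_UN .
qed

lemma tangent_point_in_K: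
  assumes "i \<in> {1..m}" "tangent_line_at (arc_param (lam i) (lam (i + 1))) L p"
  shows "p \<in> K"
proof -
  obtain t where t: "t \<in> {0..1}" "arc_param (lam i) (lam (i + 1)) t = p"
    using assms(2) unfolding tangent_line_at_def by blast
  have "(1 - t) *\<^sub>R DW_point (lam i) + t *\<^sub>R DW_point (lam (i + 1)) \<in> edge i"
    using t(1) unfolding in_segment by auto
  then show ?thesis
    using edge_subset_rel_frontier[OF assms(1)] t(2) unfolding arc_param_def by blast
qed

lemma F_eq_image_up_to_zero: "F = h_map ` P \<or> 0 \<in> lam ` {1..m} \<and> F = h_map ` P - {0}"
proof -
  have sub: "h_map ` P - {0} \<subseteq> F"
  proof
    fix z assume "z \<in> h_map ` P - {0}"
    then obtain v where v: "v \<in> P" "z = h_map v" "z \<noteq> 0" by blast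
    then have "v $ 3 \<noteq> 0" by (auto simp: h_map_proj)
    then have "0 < v $ 3" using nonneg_P[OF v(1)] by simp
    then show "z \<in> F" using v(1,2) by blast
  qed
  have super: "F \<subseteq> h_map ` P" by (rule image_mono) simp
  have "Y = X \<or> Y = X - {0} \<and> 0 \<in> X" if "X - {0} \<subseteq> Y" "Y \<subseteq> X" for X Y :: "complex set"
    using that by blast
  from this[OF sub super] show ?thesis
  proof (elim disjE conjE)
    assume eq: "F = h_map ` P - {0}" and "0 \<in> h_map ` P"
    then obtain v where v: "0 = h_map v" "v \<in> P" by (elim imageE)
    have "\<not> 0 < v $ 3"
    proof
      assume "0 < v $ 3"
      then have "h_map v \<in> F" using v(2) by (intro imageI IntI) auto
      then show False unfolding eq using v(1) by simp
    qed
    then have "v $ 3 = 0"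
      using nonneg_P[OF v(2)] by simp
    from zero_level(2)[OF v(2) this] eq show ?thesis by (intro disjI2 conjI)
  qed (rule disjI1)
qed

lemma frontier_F_subset:
  assumes "h_map ` P - interior F \<subseteq> X"
  shows "frontier F \<subseteq> X"
proof -
  have "closed (h_map ` P)"
    using compact_continuous_image[OF continuous_on_P compact_P] compact_imp_closed by blast
  then have "closure F \<subseteq> h_map ` P"
    by (intro closure_minimal) auto
  then show ?thesis
    using assms by (auto simp: frontier_def)
qed

lemma enclosed_eq:
  assumes bd: "h_map ` P - interior F \<subseteq> K \<union> X" and X: "X \<subseteq> h_map ` P"
  shows "(K \<union> X) \<union> inside (K \<union> X) = h_map ` P"
proof (rule enclosed_by_frontier)
  have comp: "compact (h_map ` P)"
    using compact_continuous_image[OF continuous_on_P compact_P] .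
  then show "bounded (h_map ` P)" by (rule compact_imp_bounded)
  obtain C where C: "C > 0" "\<And>v. v \<in> P \<Longrightarrow> cmod (proj v) \<le> C * v $ 3"
    using linear_bound by metis
  show "inside (h_map ` P) = {}"
    by (rule inside_h_image_empty[OF convex_convex_hull compact_P C])
  show "K \<union> X \<subseteq> h_map ` P"
    using X rel_frontier_subset_P by blast
  have "interior F \<subseteq> interior (h_map ` P)"
    by (intro interior_mono) auto
  then show "frontier (h_map ` P) \<subseteq> K \<union> X"
    using bd closure_closed[OF compact_imp_closed[OF comp]] by (auto simp: frontier_def)
qed

text \<open>A flat portion must contain frontier points off the closure of the arcs.\<close>

lemma no_flat_portion:
  assumes "h_map ` P - interior F \<subseteq> K"
  shows "\<not> flat_portion F m lam S"
  using frontier_F_subset[OF assms] unfolding flat_portion_def closure_arcs by blast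

text \<open>If no critical level separates the vertices, \<open>h\<close> is injective at positive height and hence
  open on the relative interior of the polygon.  The vertical planes through the
  origin, where \<open>h\<close> is far from injective, are covered by \<open>h_map_rel_frontier_vertical\<close>.\<close>

lemma boundary_without_fold:
  assumes "\<eta> \<noteq> 0" and plane: "P \<subseteq> {v. \<eta> \<bullet> v = b}"
    and bad: "\<And>\<alpha>. \<eta> $ 3 \<noteq> 0 \<Longrightarrow> b + \<alpha> * \<eta> $ 3 = 0 \<Longrightarrow>
      \<not> ((MIN i\<in>{1..m}. (cmod (lam i))\<^sup>2) < \<alpha> \<and> \<alpha> < (MAX i\<in>{1..m}. (cmod (lam i))\<^sup>2))"
  shows "h_map ` P - interior F \<subseteq> K"
proof
  fix z assume z: "z \<in> h_map ` P - interior F"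
  then obtain v where v: "v \<in> P" "z = h_map v" by blast
  show "z \<in> K"
  proof (cases "v $ 3 = 0")
    case True
    then show ?thesis
      using zero_level[OF v(1)] zero_in_K v(2) by (simp add: h_map_proj)
  next
    case False
    then have pos: "0 < v $ 3" using nonneg_P[OF v(1)] by simp
    show ?thesis
    proof (cases "\<eta> $ 3 = 0 \<and> b = 0")
      case True
      have "affine hull P = {v. \<eta> \<bullet> v = 0}"
        using affine_hull_eq_plane[OF dim assms(1) plane] True by simp
      then show ?thesis
        using h_map_rel_frontier_vertical[OF _ _ compact_P v(1) pos] True v(2) by blast
    next
      case False
      have "inj_on h_map (P \<inter> {v. 0 < v $ 3})"
      proof (rule inj_on_h_map_one_sided[OF plane])
        show "\<eta> $ 3 \<noteq> 0 \<or> b \<noteq> 0" using False by blast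
        fix \<alpha> assume "\<eta> $ 3 \<noteq> 0" "b + \<alpha> * \<eta> $ 3 = 0"
        from bad[OF this] show "(\<forall>v\<in>P. \<alpha> \<le> v $ 3) \<or> (\<forall>v\<in>P. v $ 3 \<le> \<alpha>)"
          using level_between by (meson not_le order_trans)
      qed
      then have "v \<notin> rel_interior P"
        using h_map_interior[OF dim continuous_on_P open_UNIV, of v] pos z v(2) by auto
      then have "v \<in> rel_frontier P"
        using v(1) closure_subset by (auto simp: rel_frontier_def)
      then show ?thesis using v(2) by blast
    qed
  qed
qed

text \<open>With \<open>e\<close> normalized so that \<open>e \<bullet> proj v = v $ 3 + \<alpha>\<close> on \<open>P\<close>, the range lies in the half-plane
  \<open>e \<bullet> z \<ge> 2 * sqrt \<alpha>\<close> and touches the boundary line exactly in \<open>S\<close>, the image of the chord at level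
  \<open>\<alpha>\<close>.  The ends of the chord are the only points of the polygon's relative frontier at
  that level, so the ends of \<open>S\<close> are the only points of the arcs on the line.  For
  uniqueness, a flat portion has both ends on arcs but contains a point off the arcs; that
  point lies in \<open>S\<close>, is an inner point of the portion and minimizes \<open>e \<bullet> _\<close>, so both ends
  lie on the line as well and must be the ends of \<open>S\<close>.\<close>

lemma boundary_with_fold:
  assumes plane: "P \<subseteq> {v. \<eta> \<bullet> v = b}" and "\<eta> $ 3 \<noteq> 0" and crit: "b + \<alpha> * \<eta> $ 3 = 0"
    and lo: "(MIN i\<in>{1..m}. (cmod (lam i))\<^sup>2) < \<alpha>" and hi: "\<alpha> < (MAX i\<in>{1..m}. (cmod (lam i))\<^sup>2)"
  defines "S \<equiv> h_map ` {v \<in> P. v $ 3 = \<alpha>}"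
  shows "h_map ` P - interior F \<subseteq> K \<union> S" and "closed S" and "flat_portion F m lam T \<longleftrightarrow> T = S"
proof -
  define e where "e = proj \<eta> /\<^sub>R (- \<eta> $ 3)"
  have e: "e \<bullet> proj v = v $ 3 + \<alpha>" if "v \<in> P" for v
  proof -
    have "proj \<eta> \<bullet> proj v = - \<eta> $ 3 * (v $ 3 + \<alpha>)"
      using plane that crit inner_proj[of \<eta> v] by (auto simp: algebra_simps)
    then show ?thesis
      using assms(2) by (simp add: e_def field_simps)
  qed
  have "\<alpha> > 0"
  proof -
    have "0 \<le> (MIN i\<in>{1..m}. (cmod (lam i))\<^sup>2)"
      using m_pos by simp
    then show ?thesis using lo by simp
  qed
  have pos: "0 < v $ 3" if "v \<in> P" for v
  proof (rule ccontr)
    assume "\<not> ?thesis"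
    then have "v $ 3 = 0" using nonneg_P[OF that] by simp
    then have "v = 0" by (rule zero_level(1)[OF that])
    then show False
      using e[OF that] \<open>\<alpha> > 0\<close> by (simp add: linear_0[OF linear_proj])
  qed
  then have FP: "F = h_map ` P" by blast
  have eh: "e \<bullet> h_map v = (v $ 3 + \<alpha>) / sqrt (v $ 3)" if "v \<in> P" for v
    using e[OF that] by (simp add: h_map_proj)
  have low: "2 * sqrt \<alpha> \<le> e \<bullet> h_map v" and low_iff: "e \<bullet> h_map v = 2 * sqrt \<alpha> \<longleftrightarrow> v $ 3 = \<alpha>"
    if "v \<in> P" for v
    using sqrt_level_bound[OF \<open>\<alpha> > 0\<close> pos[OF that]] eh[OF that] by auto
  have F_low: "F \<subseteq> {z. e \<bullet> z \<ge> 2 * sqrt \<alpha>}"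
    unfolding FP using low by auto

  show boundary: "h_map ` P - interior F \<subseteq> K \<union> S"
  proof
    fix z assume z: "z \<in> h_map ` P - interior F"
    then obtain v where v: "v \<in> P" "z = h_map v" by blast
    \<comment> \<open>on either side of the level \<open>h\<close> is injective, hence locally open\<close>
    have inj: "inj_on h_map (P \<inter> T \<inter> {v. 0 < v $ 3})"
      if "T = {v. \<alpha> < v $ 3} \<or> T = {v. v $ 3 < \<alpha>}" for T
    proof (rule inj_on_h_map_one_sided)
      show "P \<inter> T \<subseteq> {v. \<eta> \<bullet> v = b}" using plane by blast
      show "\<eta> $ 3 \<noteq> 0 \<or> b \<noteq> 0" using assms(2) by blast
      fix \<alpha>' assume "b + \<alpha>' * \<eta> $ 3 = 0"
      then have "\<alpha>' = \<alpha>"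
        using crit assms(2) by (metis add_left_cancel mult_cancel_right)
      then show "(\<forall>v\<in>P \<inter> T. \<alpha>' \<le> v $ 3) \<or> (\<forall>v\<in>P \<inter> T. v $ 3 \<le> \<alpha>')"
        using that by auto
    qed
    have op: "open {v :: real ^ 3. \<alpha> < v $ 3}" "open {v :: real ^ 3. v $ 3 < \<alpha>}"
      by (intro open_Collect_less continuous_intros)+
    show "z \<in> K \<union> S"
    proof (cases "v \<in> rel_interior P")
      case False
      then have "v \<in> rel_frontier P"
        using v(1) closure_subset by (auto simp: rel_frontier_def)
      then show ?thesis using v(2) by blast
    next
      case True
      have "\<not> \<alpha> < v $ 3"
        using h_map_interior[OF dim continuous_on_P op(1) _ True pos[OF v(1)]]
          inj[of "{v. \<alpha> < v $ 3}"] z v(2) by (auto simp: Int_ac)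
      moreover have "\<not> v $ 3 < \<alpha>"
        using h_map_interior[OF dim continuous_on_P op(2) _ True pos[OF v(1)]]
          inj[of "{v. v $ 3 < \<alpha>}"] z v(2) by (auto simp: Int_ac)
      ultimately show ?thesis
        using v by (auto simp: S_def)
    qed
  qed

  have vertices: "DW_point (lam i) \<in> P" if "i \<in> {1..m}" for i
    using that by (intro hull_inc) auto
  obtain i where i: "i \<in> {1..m}" "(cmod (lam i))\<^sup>2 < \<alpha>"
    using lo m_pos by (auto simp: Min_less_iff)
  obtain j where j: "j \<in> {1..m}" "\<alpha> < (cmod (lam j))\<^sup>2"
    using hi m_pos by (auto simp: Max_gr_iff)
  obtain c where c: "c \<in> rel_interior P" "c $ 3 = \<alpha>"
    using rel_interior_meets_level[OF convex_convex_hull vertices[OF i(1)] _ vertices[OF j(1)]] i j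
    by auto
  have "e \<noteq> 0"
  proof
    assume "e = 0"
    then have "v $ 3 = - \<alpha>" if "v \<in> P" for v
      using e[OF that] by simp
    from this[OF vertices[OF i(1)]] this[OF vertices[OF j(1)]] show False
      using i j by simp
  qed
  then have "proj \<eta> \<noteq> 0" by (auto simp: e_def)
  moreover have "affine hull P = {v. \<eta> \<bullet> v = b}"
    using assms(2) by (intro affine_hull_eq_plane[OF dim _ plane]) auto
  ultimately obtain p q where pq: "p \<noteq> q" "P \<inter> {v. v $ 3 = \<alpha>} = closed_segment p q"
    "rel_frontier P \<inter> {v. v $ 3 = \<alpha>} = {p, q}"
    using level_chord[OF convex_convex_hull compact_P _ _ c] by metis
  have S: "S = closed_segment (h_map p) (h_map q)"
  proof -
    have lin: "linear (\<lambda>v. (1 / sqrt \<alpha>) *\<^sub>R proj v)"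
      using linear_proj by (rule linear_compose_scale_right)
    have level: "h_map v = (1 / sqrt \<alpha>) *\<^sub>R proj v" if "v \<in> closed_segment p q" for v
      using that pq(2) by (auto simp: h_map_proj)
    have "S = h_map ` closed_segment p q"
      unfolding S_def pq(2)[symmetric] by (rule arg_cong[of _ _ "image h_map"]) blast
    also have "\<dots> = (\<lambda>v. (1 / sqrt \<alpha>) *\<^sub>R proj v) ` closed_segment p q"
      using level by (intro image_cong) auto
    also have "\<dots> = closed_segment (h_map p) (h_map q)"
      using closed_segment_linear_image[OF lin, of p q] level by simp
    finally show ?thesis .
  qed
  then show "closed S" by simp
  have pqP: "p \<in> P" "q \<in> P" "p $ 3 = \<alpha>" "q $ 3 = \<alpha>" "p \<in> rel_frontier P" "q \<in> rel_frontier P"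
    using pq rel_frontier_subset_P by blast+
  have hpq: "h_map p \<noteq> h_map q"
    using pq(1) pqP \<open>\<alpha> > 0\<close> proj_h_map[of p] proj_h_map[of q] proj_eqI[of p q] by auto
  have line: "affine hull {h_map p, h_map q} = {z. e \<bullet> z = 2 * sqrt \<alpha>}"
  proof (rule affine_dim_equal)
    show "affine hull {h_map p, h_map q} \<subseteq> {z. e \<bullet> z = 2 * sqrt \<alpha>}"
      using low_iff pqP by (intro hull_minimal affine_hyperplane) auto
  qed (use \<open>e \<noteq> 0\<close> hpq in \<open>auto simp: affine_hyperplane aff_dim_2\<close>)
  have tangent: "tangent_line_at (arc_param (lam i) (lam (i + 1))) (affine hull {h_map p, h_map q}) (h_map v)"
    if "i \<in> {1..m}" "v \<in> edge i" "v $ 3 = \<alpha>" for i v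
  proof -
    have "edge i \<subseteq> P"
      using edge_subset_rel_frontier[OF that(1)] rel_frontier_subset_P by blast
    then have "DW_point (lam i) \<in> P" "DW_point (lam (i + 1)) \<in> P" by auto
    from this[THEN e] show ?thesis
      unfolding line using that by (intro tangent_at_critical_level \<open>\<alpha> > 0\<close>) auto
  qed
  \<comment> \<open>\<open>c\<close> witnesses that the segment leaves the arcs: on the level, \<open>h\<close> is injective\<close>
  have hc: "h_map c \<in> S" "h_map c \<notin> K"
  proof -
    have "c \<in> P" using c(1) rel_interior_subset by blast
    then show "h_map c \<in> S" using c(2) by (auto simp: S_def)
    show "h_map c \<notin> K"
    proof
      assume "h_map c \<in> K"
      then obtain v where v: "v \<in> rel_frontier P" "h_map v = h_map c" by (metis imageE)
      then have "v $ 3 = \<alpha>"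
        using low_iff[of v] low_iff[of c] \<open>c \<in> P\<close> c(2) rel_frontier_subset_P by auto
      then have "v = c"
        using v(2) c(2) \<open>\<alpha> > 0\<close> proj_h_map[of v] proj_h_map[of c] by (intro proj_eqI) auto
      then show False
        using v(1) c(1) by (simp add: rel_frontier_def)
    qed
  qed
  have "flat_portion F m lam S"
  proof -
    obtain i where i: "i \<in> {1..m}" "p \<in> edge i"
      using pqP(5) unfolding rel_frontier_P by blast
    obtain j where j: "j \<in> {1..m}" "q \<in> edge j"
      using pqP(6) unfolding rel_frontier_P by blast
    have "i \<noteq> j"
    proof
      assume "i = j"
      then have "closed_segment p q \<subseteq> edge i"
        using i j by (intro closed_segment_subset convex_closed_segment) auto
      moreover have "c \<in> closed_segment p q"
        using c rel_interior_subset pq(2) by blast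
      ultimately have "c \<in> rel_frontier P"
        using edge_subset_rel_frontier[OF i(1)] by blast
      then show False
        using c(1) by (simp add: rel_frontier_def)
    qed
    moreover have "S \<subseteq> frontier F"
    proof
      fix z assume "z \<in> S"
      then obtain v where v: "v \<in> P" "v $ 3 = \<alpha>" "z = h_map v" by (auto simp: S_def)
      then have "e \<bullet> z = 2 * sqrt \<alpha>" using low_iff by auto
      then have "z \<notin> interior F"
        using interior_mono[OF F_low] \<open>e \<noteq> 0\<close> by auto
      moreover have "z \<in> closure F"
        using v FP closure_subset by blast
      ultimately show "z \<in> frontier F" by (simp add: frontier_def)
    qed
    moreover have "\<not> S \<subseteq> closure (\<Union>(arcs m lam))"
      using hc closure_arcs by blast
    ultimately show ?thesis
      unfolding flat_portion_def using S hpq i j tangent[OF i pqP(3)] tangent[OF j pqP(4)] by blast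
  qed
  moreover have "T = S" if T: "flat_portion F m lam T"
  proof -
    obtain p' q' i j where pq': "p' \<noteq> q'" "T = closed_segment p' q'" "i \<in> {1..m}" "j \<in> {1..m}"
      "tangent_line_at (arc_param (lam i) (lam (i + 1))) (affine hull {p', q'}) p'"
      "tangent_line_at (arc_param (lam j) (lam (j + 1))) (affine hull {p', q'}) q'"
      and T': "T \<subseteq> frontier F" "\<not> T \<subseteq> K"
      using T unfolding flat_portion_def closure_arcs by blast
    have K': "p' \<in> K" "q' \<in> K"
      using tangent_point_in_K[OF pq'(3,5)] tangent_point_in_K[OF pq'(4,6)] by blast+
    obtain z where z: "z \<in> T" "z \<notin> K" using T' by blast
    then have "z \<in> S"
      using T'(1) frontier_F_subset[OF boundary] by blast
    then have ez: "e \<bullet> z = 2 * sqrt \<alpha>"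
      using low_iff by (auto simp: S_def)
    \<comment> \<open>the ends lie on arcs while \<open>z\<close> does not\<close>
    have "z \<in> open_segment p' q'"
      using z K' pq'(2) by (auto simp: open_segment_def)
    then obtain t where t: "0 < t" "t < 1" "z = (1 - t) *\<^sub>R p' + t *\<^sub>R q'"
      by (auto simp: in_segment)
    have onK: "e \<bullet> x \<ge> 2 * sqrt \<alpha>" "e \<bullet> x = 2 * sqrt \<alpha> \<Longrightarrow> x \<in> {h_map p, h_map q}" if "x \<in> K" for x
    proof -
      from that obtain v where v: "v \<in> rel_frontier P" "x = h_map v" by blast
      then have "v \<in> P" using rel_frontier_subset_P by blast
      then show "e \<bullet> x \<ge> 2 * sqrt \<alpha>" using low v by simp
      assume "e \<bullet> x = 2 * sqrt \<alpha>"
      then have "v $ 3 = \<alpha>" using low_iff \<open>v \<in> P\<close> v(2) by simp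
      then show "x \<in> {h_map p, h_map q}" using v pq(3) by auto
    qed
    have "(1 - t) * (e \<bullet> p' - 2 * sqrt \<alpha>) + t * (e \<bullet> q' - 2 * sqrt \<alpha>) = 0"
      using ez unfolding t(3) by (simp add: inner_add_right algebra_simps)
    moreover have "0 \<le> (1 - t) * (e \<bullet> p' - 2 * sqrt \<alpha>)" "0 \<le> t * (e \<bullet> q' - 2 * sqrt \<alpha>)"
      using t(1,2) onK(1) K' by auto
    ultimately have "(1 - t) * (e \<bullet> p' - 2 * sqrt \<alpha>) = 0" "t * (e \<bullet> q' - 2 * sqrt \<alpha>) = 0"
      by linarith+
    then have "e \<bullet> p' = 2 * sqrt \<alpha>" "e \<bullet> q' = 2 * sqrt \<alpha>"
      using t(1,2) by auto
    then have "p' \<in> {h_map p, h_map q}" "q' \<in> {h_map p, h_map q}"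
      using onK(2) K' by auto
    then show ?thesis
      using pq'(1,2) S by (auto simp: closed_segment_commute)
  qed
  ultimately show "flat_portion F m lam T \<longleftrightarrow> T = S" by blast
qed

end

section \<open>The normalized numerical range of a normal matrix\<close>

theorem theorem4p2:
  fixes A :: "complex ^ 'n ^ 'n" and m :: nat and lam :: "nat \<Rightarrow> complex"
  assumes "normal_matrix A"
    and "inj_on lam {1..m}" and "lam ` {1..m} = eigenvalues A"
    and "aff_dim (DW A) = 2"
    and "lam (m + 1) = lam 1"
    and "{e. e edge_of DW A} =
      (\<lambda>i. closed_segment (DW_point (lam i)) (DW_point (lam (i + 1)))) ` {1..m}"
  shows "(let F = normalized_numrange A;
              flats = {S. flat_portion F m lam S};
              E = enclosed (arcs m lam \<union> flats);
              good = (\<lambda>\<alpha>. is_critical_level A \<alpha> \<and>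
                (MIN i\<in>{1..m}. (cmod (lam i))\<^sup>2) < \<alpha> \<and> \<alpha> < (MAX i\<in>{1..m}. (cmod (lam i))\<^sup>2))
          in (flats = {} \<or> (\<exists>S. flats = {S})) \<and>
             (F = E \<or> 0 \<in> eigenvalues A \<and> F = E - {0}) \<and>
             (flats \<noteq> {} \<longleftrightarrow> (\<exists>\<alpha>. good \<alpha>)) \<and>
             (\<forall>\<alpha>. good \<alpha> \<longrightarrow> flats = {h_map ` {v \<in> DW A. v $ 3 = \<alpha>}}))"
proof -
  have DW: "DW A = convex hull (DW_point ` lam ` {1..m})"
    using normal_DW_convex_hull[OF assms(1)] assms(3) by simp
  interpret shell_polygon m lam
    by (rule shell_polygon.intro) (fact assms(4,6)[unfolded DW])+
  have NF: "normalized_numrange A = F"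
    by (simp add: normalized_numrange_h_map DW)
  let ?good = "\<lambda>\<alpha>. is_critical_level A \<alpha> \<and>
    (MIN i\<in>{1..m}. (cmod (lam i))\<^sup>2) < \<alpha> \<and> \<alpha> < (MAX i\<in>{1..m}. (cmod (lam i))\<^sup>2)"
  let ?flats = "{S. flat_portion F m lam S}"
  have fold: "?flats = {h_map ` {v \<in> P. v $ 3 = \<alpha>}} \<and>
      h_map ` P - interior F \<subseteq> K \<union> h_map ` {v \<in> P. v $ 3 = \<alpha>} \<and> closed (h_map ` {v \<in> P. v $ 3 = \<alpha>})"
    if good: "?good \<alpha>" for \<alpha>
  proof -
    obtain \<eta> b where "P \<subseteq> {v. \<eta> \<bullet> v = b}" "\<eta> $ 3 \<noteq> 0" "b + \<alpha> * \<eta> $ 3 = 0"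
      using good by (auto simp: is_critical_level_def DW)
    note bwf = boundary_with_fold[OF this conjunct1[OF conjunct2[OF good]] conjunct2[OF conjunct2[OF good]]]
    show ?thesis
      unfolding bwf(3) using bwf(1,2) by (intro conjI) (simp_all only: singleton_conv)
  qed
  have no_fold: "?flats = {} \<and> h_map ` P - interior F \<subseteq> K" if bad: "\<nexists>\<alpha>. ?good \<alpha>"
  proof -
    obtain \<eta> b where \<eta>: "\<eta> \<noteq> 0" "P \<subseteq> {v. \<eta> \<bullet> v = b}"
      using aff_lowdim_subset_hyperplane[of P] dim by auto
    have "h_map ` P - interior F \<subseteq> K"
    proof (rule boundary_without_fold[OF \<eta>])
      fix \<alpha> assume "\<eta> $ 3 \<noteq> 0" "b + \<alpha> * \<eta> $ 3 = 0"
      then have "is_critical_level A \<alpha>"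
        using \<eta>(2) by (auto simp: is_critical_level_def DW)
      with bad show "\<not> ((MIN i\<in>{1..m}. (cmod (lam i))\<^sup>2) < \<alpha> \<and> \<alpha> < (MAX i\<in>{1..m}. (cmod (lam i))\<^sup>2))"
        by blast
    qed
    then show ?thesis using no_flat_portion by blast
  qed
  have "enclosed (arcs m lam \<union> ?flats) = h_map ` P"
  proof -
    have "closure (\<Union>(arcs m lam \<union> ?flats)) = K \<union> \<Union>?flats \<and> h_map ` P - interior F \<subseteq> K \<union> \<Union>?flats
        \<and> \<Union>?flats \<subseteq> h_map ` P"
    proof (cases "\<exists>\<alpha>. ?good \<alpha>")
      case True
      then obtain \<alpha> where "?good \<alpha>" ..
      from fold[OF this] show ?thesis
        by (auto simp: closure_arcs)
    next
      case False
      from no_fold[OF this] show ?thesis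
        by (simp add: closure_arcs)
    qed
    then show ?thesis
      unfolding enclosed_def using enclosed_eq[of "\<Union>?flats"] by simp
  qed
  then have "F = enclosed (arcs m lam \<union> ?flats) \<or>
      0 \<in> eigenvalues A \<and> F = enclosed (arcs m lam \<union> ?flats) - {0}"
    using F_eq_image_up_to_zero assms(3) by simp
  moreover have "?flats = {} \<or> (\<exists>S. ?flats = {S})"
    using fold no_fold by blast
  moreover have "?flats \<noteq> {} \<longleftrightarrow> (\<exists>\<alpha>. ?good \<alpha>)"
    using fold no_fold by blast
  moreover have "\<forall>\<alpha>. ?good \<alpha> \<longrightarrow> ?flats = {h_map ` {v \<in> P. v $ 3 = \<alpha>}}"
    using fold by blast
  ultimately show ?thesis
    unfolding Let_def NF DW[symmetric] by (iprover intro: conjI)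
qed

end
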